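(* Let $\mathbf w^0$ be the vector with $\mathbf w^0_i=\delta_{0i}$, $i\in\mathbb Z$. For every $\mathbf v$, the irreducible components of $\mathcal L(\mathbf v,\mathbf w^0)$ (type $A_\infty$) are precisely those $X_f$ where $f\in\tilde Z^\infty_{\mathbf V}$ is such that $$\{(k',k) : f(k',k)=1\}=A_Y$$ for some Young diagram $Y\in\mathcal Y$ and $f(k',k)=0$ for $(k',k)\notin A_Y$. Denote the component corresponding to such an $f$ by $X_Y$. Then $Y\leftrightarrow X_Y$ is a one-to-one correspondence between the set $\mathcal Y$ and the set of irreducible components of $\bigcup_{\mathbf v}\mathcal L(\mathbf v,\mathbf w^0)$ (i.e. the disjoint union over all $\mathbf v$ of the sets of irreducible components of $\mathcal L(\mathbf v,\mathbf w^0)$).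
   Context: Quiver. $I=\mathbb Z$. For every $i\in I$ there is an arrow $i\to i-1$ (with $\mathrm{out}=i$, $\mathrm{in}=i-1$) and an opposite arrow $i\leftarrow i-1$ (with $\mathrm{out}=i-1$, $\mathrm{in}=i$). $\Omega$ is the set of arrows $i\to i-1$, $\bar\Omega$ the set of arrows $i\leftarrow i-1$, $H=\Omega\sqcup\bar\Omega$, and $h\mapsto\bar h$ interchanges $i\to i-1$ and $i\leftarrow i-1$. $\varepsilon(h)=1$ for $h\in\Omega$, $\varepsilon(h)=-1$ for $h\in\bar\Omega$. For a finite-dimensional $I$-graded complex vector space $\mathbf V=\bigoplus_i\mathbf V_i$ of graded dimension $\mathbf v$, let $\mathbf E_{\mathbf V}=\bigoplus_{h\in H}\mathrm{Hom}(\mathbf V_{\mathrm{out}(h)},\mathbf V_{\mathrm{in}(h)})$, let $\mathbf E_{\mathbf V,\Omega}$, $\mathbf E_{\mathbf V,\bar\Omega}$ be the subspaces of $x$ with $x_h=0$ for $h\notin\Omega$, resp. $h\notin\bar\Omega$, and let $G_{\mathbf V}=\prod_i\mathrm{Aut}(\mathbf V_i)$ act by $(gx)_h=g_{\mathrm{in}(h)}x_hg_{\mathrm{out}(h)}^{-1}$. Put $\langle x,y\rangle=\sum_{h\in H}\varepsilon(h)\,\mathrm{tr}(x_hy_{\bar h})$ and $\psi_i(x)=\sum_{h\in H,\ \mathrm{in}(h)=i}\varepsilon(h)x_hx_{\bar h}\in\mathrm{End}(\mathbf V_i)$. $x\in\mathbf E_{\mathbf V}$ is nilpotent if for some $N\ge1$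 all compositions $x_{h_1}\cdots x_{h_N}$ along composable sequences of $N$ arrows vanish. $\Lambda_{\mathbf V}$ is the set of nilpotent $x\in\mathbf E_{\mathbf V}$ with $\psi_i(x)=0$ for all $i$. Orbits. For integers $k'\le k$ let $x_\infty(k',k)$ be the representation of $(I,\Omega)$ with basis $e_r$ ($k'\le r\le k$), $e_r$ of degree $r$, $e_r\mapsto e_{r-1}$, $e_{k'-1}=0$. $Z^\infty$ is the set of pairs of integers $(k'\le k)$; $\tilde Z^\infty$ is the set of finitely supported functions $Z^\infty\to\mathbb N$ ($\mathbb N\ni0$); $\tilde Z^\infty_{\mathbf V}$ is the subset of those $f$ with $\sum_{k'\le i\le k}f(k',k)=\dim\mathbf V_i$ for all $i$. For $f\in\tilde Z^\infty_{\mathbf V}$, $\mathcal O_f\subset\mathbf E_{\mathbf V,\Omega}$ is the $G_{\mathbf V}$-orbit of representations isomorphic to $\bigoplus x_\infty(k',k)^{\oplus f(k',k)}$; $\mathcal C_f\subset\mathbf E_{\mathbf V}$ is its conormal bundle, i.e. the set of $x'+x''$ with $x'\in\mathcal O_f$, $x''\in\mathbf E_{\mathbf V,\bar\Omega}$ orthogonal under $\langle\,,\rangle$ to the tangent space of $\mathcal O_f$ at $x'$; $\bar{\mathcal C}_f$ is its closure. Nakajima varieties. For $I$-graded $\mathbf V,\mathbf W$ of finite graded dimensions $\mathbf v,\mathbf w$, let $\Lambda(\mathbf v,\mathbf w)=\Lambda_{\mathbf V}\times\bigoplus_i\mathrm{Hom}(\mathbf V_i,\mathbf W_i)$ with $G_{\mathbf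 V}$-action $g(x,j)=(gx,(j_ig_i^{-1}))$; $\Lambda(\mathbf v,\mathbf w)^{\mathrm{st}}$ is the set of $(x,j)$ such that the only graded subspace $\mathbf S\subset\mathbf V$ with $x(\mathbf S)\subset\mathbf S$ and $j(\mathbf S)=0$ is $0$; $\mathcal L(\mathbf v,\mathbf w)=\Lambda(\mathbf v,\mathbf w)^{\mathrm{st}}/G_{\mathbf V}$ (the action is free). Put $X_f=\big((\bar{\mathcal C}_f\times\bigoplus_i\mathrm{Hom}(\mathbf V_i,\mathbf W_i))\cap\Lambda(\mathbf v,\mathbf w)^{\mathrm{st}}\big)/G_{\mathbf V}$. Young diagrams. $\mathcal Y$ is the set of Young diagrams $Y=[l_1,\dots,l_s]$, i.e. weakly decreasing sequences, written with $l_s>0$ (and $l_j=0$ for $j>s$; $s=0$ for the empty diagram). $A_Y=\{(1-i,l_i-i) : 1\le i\le s\}$. *)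

theory Defs
  imports
    "HOL-Analysis.Abstract_Topology"
    "Jordan_Normal_Form.Gauss_Jordan_Elimination"
    "Jordan_Normal_Form.VS_Connect"
begin

section \<open>Zariski topology, tangent spaces, irreducible components, quotients\<close>

text \<open>Polynomial functions on a space of points whose coordinate functions are collected in \<open>C\<close>.\<close>

inductive_set poly_funs :: "('p \<Rightarrow> complex) set \<Rightarrow> ('p \<Rightarrow> complex) set"
  for C :: "('p \<Rightarrow> complex) set"
where
  const: "(\<lambda>_. c) \<in> poly_funs C"
| coord: "\<phi> \<in> C \<Longrightarrow> \<phi> \<in> poly_funs C"
| add: "\<phi> \<in> poly_funs C \<Longrightarrow> \<psi> \<in> poly_funs C \<Longrightarrow> (\<lambda>p. \<phi> p + \<psi> p) \<in> poly_funs C"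
| mult: "\<phi> \<in> poly_funs C \<Longrightarrow> \<psi> \<in> poly_funs C \<Longrightarrow> (\<lambda>p. \<phi> p * \<psi> p) \<in> poly_funs C"

definition zariski :: "('p \<Rightarrow> complex) set \<Rightarrow> 'p set \<Rightarrow> 'p topology" where
  "zariski C M = topology (\<lambda>U. \<exists>S \<subseteq> poly_funs C. U = {p \<in> M. \<exists>\<phi>\<in>S. \<phi> p \<noteq> 0})"

lemma openin_zariski:
  "openin (zariski C M) U \<longleftrightarrow> (\<exists>S \<subseteq> poly_funs C. U = {p \<in> M. \<exists>\<phi>\<in>S. \<phi> p \<noteq> 0})"
proof -
  define P where "P U \<longleftrightarrow> (\<exists>S \<subseteq> poly_funs C. U = {p \<in> M. \<exists>\<phi>\<in>S. \<phi> p \<noteq> 0})" for U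
  have "P (U \<inter> V)" if U: "P U" and V: "P V" for U V
  proof -
    from U obtain S where S: "S \<subseteq> poly_funs C" "U = {p \<in> M. \<exists>\<phi>\<in>S. \<phi> p \<noteq> 0}"
      unfolding P_def by (elim exE conjE) (rule that)
    from V obtain T where T: "T \<subseteq> poly_funs C" "V = {p \<in> M. \<exists>\<phi>\<in>T. \<phi> p \<noteq> 0}"
      unfolding P_def by (elim exE conjE) (rule that)
    define R where "R = (\<lambda>(\<phi>, \<psi>) p. \<phi> p * \<psi> p) ` (S \<times> T)"
    have "R \<subseteq> poly_funs C"
    proof
      fix \<rho> assume "\<rho> \<in> R"
      then obtain \<phi> \<psi> where "\<phi> \<in> S" "\<psi> \<in> T" "\<rho> = (\<lambda>p. \<phi> p * \<psi> p)"
        unfolding R_def by auto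
      then show "\<rho> \<in> poly_funs C"
        using S(1) T(1) poly_funs.mult[of \<phi> C \<psi>] by (simp add: subset_iff)
    qed
    moreover have "(p \<in> U \<inter> V) = (p \<in> {p \<in> M. \<exists>\<phi>\<in>R. \<phi> p \<noteq> 0})" for p
      unfolding S(2) T(2) R_def by simp blast
    then have "U \<inter> V = {p \<in> M. \<exists>\<phi>\<in>R. \<phi> p \<noteq> 0}"
      by (rule Set.set_eqI)
    ultimately show ?thesis
      unfolding P_def by (intro exI[of _ R] conjI)
  qed
  moreover have "P (\<Union>K)" if K: "\<forall>U\<in>K. P U" for K
  proof -
    obtain S where S: "\<forall>U\<in>K. S U \<subseteq> poly_funs C \<and> U = {p \<in> M. \<exists>\<phi>\<in>S U. \<phi> p \<noteq> 0}"
      using bchoice[OF K[unfolded P_def]] by (elim exE) (rule that)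
    have "(p \<in> U) = (p \<in> M \<and> (\<exists>\<phi>\<in>S U. \<phi> p \<noteq> 0))" if "U \<in> K" for p U
    proof -
      have "U = {p \<in> M. \<exists>\<phi>\<in>S U. \<phi> p \<noteq> 0}" using S that by blast
      then have "(p \<in> U) = (p \<in> {p \<in> M. \<exists>\<phi>\<in>S U. \<phi> p \<noteq> 0})" by (rule arg_cong)
      then show ?thesis by (simp only: mem_Collect_eq)
    qed
    then have "(p \<in> \<Union>K) = (p \<in> {p \<in> M. \<exists>\<phi>\<in>(\<Union>U\<in>K. S U). \<phi> p \<noteq> 0})" for p
      by blast
    then have "\<Union>K = {p \<in> M. \<exists>\<phi>\<in>(\<Union>U\<in>K. S U). \<phi> p \<noteq> 0}"
      by (rule Set.set_eqI)
    moreover have "(\<Union>U\<in>K. S U) \<subseteq> poly_funs C"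
      using S by (intro UN_least) blast
    ultimately show ?thesis
      unfolding P_def by (intro exI[of _ "\<Union>U\<in>K. S U"] conjI)
  qed
  ultimately have "istopology P" unfolding istopology_def by simp
  then have "openin (topology P) = P" by (rule topology_inverse')
  then show ?thesis unfolding zariski_def P_def by (rule fun_cong)
qed

lemma topspace_zariski: "topspace (zariski C M) = M"
proof (rule subset_antisym)
  have 1: "{\<lambda>_. 1} \<subseteq> poly_funs C"
    using poly_funs.const[of 1 C] by simp
  have 2: "M = {p \<in> M. \<exists>\<phi>\<in>{\<lambda>_. 1 :: complex}. \<phi> p \<noteq> 0}"
    by simp
  have "openin (zariski C M) M"
    unfolding openin_zariski using 1 2 by (intro exI conjI)
  then show "M \<subseteq> topspace (zariski C M)"
    by (rule openin_subset)
next
  obtain S where "S \<subseteq> poly_funs C" "topspace (zariski C M) = {p \<in> M. \<exists>\<phi>\<in>S. \<phi> p \<noteq> 0}"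
    using openin_topspace[of "zariski C M"] unfolding openin_zariski
    by (elim exE conjE) (rule that)
  then show "topspace (zariski C M) \<subseteq> M"
    by simp
qed

definition irreducible_in :: "'p topology \<Rightarrow> 'p set \<Rightarrow> bool" where
  "irreducible_in X S \<longleftrightarrow> S \<subseteq> topspace X \<and> S \<noteq> {} \<and>
     (\<forall>A B. closedin X A \<and> closedin X B \<and> S \<subseteq> A \<union> B \<longrightarrow> S \<subseteq> A \<or> S \<subseteq> B)"

definition irreducible_components :: "'p topology \<Rightarrow> 'p set set" where
  "irreducible_components X =
     {S. irreducible_in X S \<and> (\<forall>T. irreducible_in X T \<and> S \<subseteq> T \<longrightarrow> T = S)}"

definition quotient_topology :: "'p topology \<Rightarrow> ('p \<Rightarrow> 'q) \<Rightarrow> 'q topology" where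
  "quotient_topology X q =
     topology (\<lambda>U. U \<subseteq> q ` topspace X \<and> openin X {p \<in> topspace X. q p \<in> U})"

lemma openin_quotient_topology:
  "openin (quotient_topology X q) U \<longleftrightarrow>
     U \<subseteq> q ` topspace X \<and> openin X {p \<in> topspace X. q p \<in> U}"
proof -
  let ?P = "\<lambda>U. U \<subseteq> q ` topspace X \<and> openin X {p \<in> topspace X. q p \<in> U}"
  have "?P (U \<inter> V)" if "?P U" "?P V" for U V
  proof -
    have "{p \<in> topspace X. q p \<in> U \<inter> V} = {p \<in> topspace X. q p \<in> U} \<inter> {p \<in> topspace X. q p \<in> V}"
      by auto
    then show ?thesis using that by auto
  qed
  moreover have "?P (\<Union>K)" if "\<forall>U\<in>K. ?P U" for K
  proof -
    have "{p \<in> topspace X. q p \<in> \<Union>K} = (\<Union>U\<in>K. {p \<in> topspace X. q p \<in> U})"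
      by auto
    then show ?thesis using that by auto
  qed
  ultimately have "istopology ?P" unfolding istopology_def by blast
  then show ?thesis unfolding quotient_topology_def by simp
qed

lemma quotient_map_quotient_topology: "quotient_map X (quotient_topology X q) q"
proof -
  have "{p \<in> topspace X. q p \<in> q ` topspace X} = topspace X" by auto
  then have "openin (quotient_topology X q) (q ` topspace X)"
    by (simp add: openin_quotient_topology)
  moreover have "topspace (quotient_topology X q) \<subseteq> q ` topspace X"
    using openin_topspace[of "quotient_topology X q"] unfolding openin_quotient_topology by simp
  ultimately have "topspace (quotient_topology X q) = q ` topspace X"
    by (intro subset_antisym openin_subset)
  then show ?thesis unfolding quotient_map_def by (auto simp: openin_quotient_topology)
qed

section \<open>The quiver and its representations\<close>

text \<open>\<open>Down i\<close> is the arrow from \<open>i\<close> to \<open>i - 1\<close>, an element of \<open>\<Omega>\<close>; \<open>Up i\<close> is the opposite arrow.\<close>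

datatype arrow = Down int | Up int

fun src :: "arrow \<Rightarrow> int" where
  "src (Down i) = i"
| "src (Up i) = i - 1"

fun tgt :: "arrow \<Rightarrow> int" where
  "tgt (Down i) = i - 1"
| "tgt (Up i) = i"

fun opp :: "arrow \<Rightarrow> arrow" where
  "opp (Down i) = Up i"
| "opp (Up i) = Down i"

definition Omega :: "arrow set" where
  "Omega = range Down"

definition Omega_bar :: "arrow set" where
  "Omega_bar = range Up"

definition eps :: "arrow \<Rightarrow> complex" where
  "eps h = (if h \<in> Omega then 1 else - 1)"

text \<open>
  A graded dimension is a finitely supported \<open>v :: int \<Rightarrow> nat\<close>, and the graded space of dimension
  \<open>v\<close> is the coordinate space with \<open>\<bold>V\<^sub>i = \<complex>\<close> to the power \<open>v i\<close>.
  An element of \<open>\<bold>E\<^sub>V\<close> assigns to every arrow a matrix of the prescribed size (possibly with no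
  rows or no columns).
\<close>

definition graded_dims :: "(int \<Rightarrow> nat) set" where
  "graded_dims = {v. finite {i. v i \<noteq> 0}}"

type_synonym rep = "arrow \<Rightarrow> complex mat"
type_synonym gmat = "int \<Rightarrow> complex mat"

definition E :: "(int \<Rightarrow> nat) \<Rightarrow> rep set" where
  "E v = {x. \<forall>h. x h \<in> carrier_mat (v (tgt h)) (v (src h))}"

definition E_on :: "arrow set \<Rightarrow> (int \<Rightarrow> nat) \<Rightarrow> rep set" where
  "E_on A v = {x \<in> E v. \<forall>h. h \<notin> A \<longrightarrow> x h = 0\<^sub>m (v (tgt h)) (v (src h))}"

definition GV :: "(int \<Rightarrow> nat) \<Rightarrow> gmat set" where
  "GV v = {g. \<forall>i. g i \<in> carrier_mat (v i) (v i) \<and> invertible_mat (g i)}"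

text \<open>\<open>mat_inverse\<close> returns \<open>Some\<close> inverse on every invertible matrix.\<close>

definition inv_at :: "gmat \<Rightarrow> int \<Rightarrow> complex mat" where
  "inv_at g i = the (mat_inverse (g i))"

definition rep_act :: "gmat \<Rightarrow> rep \<Rightarrow> rep" where
  "rep_act g x = (\<lambda>h. g (tgt h) * x h * inv_at g (src h))"

definition mat_trace :: "complex mat \<Rightarrow> complex" where
  "mat_trace A = (\<Sum>a<dim_row A. A $$ (a, a))"

text \<open>
  The summation is over all arrows; those with \<open>v (src h) = 0\<close> are left out to make the index set
  finite, since there \<open>x h * y (opp h)\<close> factors through the zero space.
\<close>

definition pairing :: "(int \<Rightarrow> nat) \<Rightarrow> rep \<Rightarrow> rep \<Rightarrow> complex" where
  "pairing v x y = (\<Sum>h | v (src h) \<noteq> 0. eps h * mat_trace (x h * y (opp h)))"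

text \<open>The sum of matrices is written entrywise, as matrices of unspecified size do not form a monoid.\<close>

definition psi :: "(int \<Rightarrow> nat) \<Rightarrow> int \<Rightarrow> rep \<Rightarrow> complex mat" where
  "psi v i x = mat (v i) (v i) (\<lambda>(a, b). \<Sum>h | tgt h = i. eps h * (x h * x (opp h)) $$ (a, b))"

definition composable :: "arrow list \<Rightarrow> bool" where
  "composable hs \<longleftrightarrow> successively (\<lambda>h h'. src h = tgt h') hs"

definition path_map :: "(int \<Rightarrow> nat) \<Rightarrow> rep \<Rightarrow> arrow list \<Rightarrow> complex mat" where
  "path_map v x hs = foldr (\<lambda>h A. x h * A) hs (1\<^sub>m (v (src (last hs))))"

definition nilpotent_rep :: "(int \<Rightarrow> nat) \<Rightarrow> rep \<Rightarrow> bool" where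
  "nilpotent_rep v x \<longleftrightarrow> (\<exists>N\<ge>1. \<forall>hs. length hs = N \<and> composable hs \<longrightarrow>
     path_map v x hs = 0\<^sub>m (v (tgt (hd hs))) (v (src (last hs))))"

definition Lam :: "(int \<Rightarrow> nat) \<Rightarrow> rep set" where
  "Lam v = {x \<in> E v. nilpotent_rep v x \<and> (\<forall>i. psi v i x = 0\<^sub>m (v i) (v i))}"

definition rep_coords :: "(int \<Rightarrow> nat) \<Rightarrow> (rep \<Rightarrow> complex) set" where
  "rep_coords v = {(\<lambda>x. x h $$ (a, b)) | h a b. a < v (tgt h) \<and> b < v (src h)}"

text \<open>
  The tangent space at \<open>p\<close> of a locally closed subvariety \<open>S\<close> of \<open>\<bold>E\<^sub>V\<close>: the vectors in whose direction
  the derivative at \<open>p\<close> of every polynomial function vanishing on \<open>S\<close> is zero.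
\<close>

definition tangent_space :: "(int \<Rightarrow> nat) \<Rightarrow> rep set \<Rightarrow> rep \<Rightarrow> rep set" where
  "tangent_space v S p = {t \<in> E v. \<forall>\<phi>\<in>poly_funs (rep_coords v). (\<forall>q\<in>S. \<phi> q = 0) \<longrightarrow>
     ((\<lambda>c. \<phi> (\<lambda>h. p h + c \<cdot>\<^sub>m t h)) has_field_derivative 0) (at 0)}"

section \<open>Orbits and conormal bundles\<close>

definition Zinf :: "(int \<times> int) set" where
  "Zinf = {(k', k). k' \<le> k}"

text \<open>Functions on \<open>Zinf\<close> are extended by zero to all pairs of integers.\<close>

definition Ztilde :: "(int \<times> int \<Rightarrow> nat) set" where
  "Ztilde = {f. finite {p. f p \<noteq> 0} \<and> {p. f p \<noteq> 0} \<subseteq> Zinf}"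

definition graded_dim :: "(int \<times> int \<Rightarrow> nat) \<Rightarrow> int \<Rightarrow> nat" where
  "graded_dim f i = (\<Sum>p | f p \<noteq> 0 \<and> fst p \<le> i \<and> i \<le> snd p. f p)"

definition Ztilde_of :: "(int \<Rightarrow> nat) \<Rightarrow> (int \<times> int \<Rightarrow> nat) set" where
  "Ztilde_of v = {f \<in> Ztilde. \<forall>i. graded_dim f i = v i}"

definition interval_dim :: "int \<times> int \<Rightarrow> int \<Rightarrow> nat" where
  "interval_dim p r = (if fst p \<le> r \<and> r \<le> snd p then 1 else 0)"

text \<open>\<open>x\<^sub>\<infinity>(k', k)\<close>, as an element of \<open>E (interval_dim (k', k))\<close>.\<close>

definition interval_rep :: "int \<times> int \<Rightarrow> rep" where
  "interval_rep p h = mat (interval_dim p (tgt h)) (interval_dim p (src h))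
     (\<lambda>_. if h \<in> Omega then 1 else 0)"

definition direct_sum :: "(int \<times> int) list \<Rightarrow> rep" where
  "direct_sum ps h = diag_block_mat (map (\<lambda>p. interval_rep p h) ps)"

text \<open>
  The list \<open>ps\<close> enumerates the summands: each \<open>p\<close> occurs \<open>f p\<close> times. The order does not affect the orbit.
\<close>

definition orbit_of :: "(int \<Rightarrow> nat) \<Rightarrow> (int \<times> int \<Rightarrow> nat) \<Rightarrow> rep set" where
  "orbit_of v f = {rep_act g (direct_sum ps) | g ps. g \<in> GV v \<and> (\<forall>p. count_list ps p = f p)}"

definition conormal :: "(int \<Rightarrow> nat) \<Rightarrow> (int \<times> int \<Rightarrow> nat) \<Rightarrow> rep set" where
  "conormal v f = {(\<lambda>h. x' h + x'' h) | x' x''. x' \<in> orbit_of v f \<and> x'' \<in> E_on Omega_bar v \<and>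
     (\<forall>t\<in>tangent_space v (orbit_of v f) x'. pairing v t x'' = 0)}"

definition conormal_closure :: "(int \<Rightarrow> nat) \<Rightarrow> (int \<times> int \<Rightarrow> nat) \<Rightarrow> rep set" where
  "conormal_closure v f = (zariski (rep_coords v) (E v)) closure_of (conormal v f)"

section \<open>Nakajima varieties\<close>

definition homVW :: "(int \<Rightarrow> nat) \<Rightarrow> (int \<Rightarrow> nat) \<Rightarrow> gmat set" where
  "homVW v w = {j. \<forall>i. j i \<in> carrier_mat (w i) (v i)}"

definition framed_act :: "gmat \<Rightarrow> rep \<times> gmat \<Rightarrow> rep \<times> gmat" where
  "framed_act g p = (rep_act g (fst p), \<lambda>i. snd p i * inv_at g i)"

definition stable :: "(int \<Rightarrow> nat) \<Rightarrow> (int \<Rightarrow> nat) \<Rightarrow> rep \<times> gmat \<Rightarrow> bool" where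
  "stable v w p \<longleftrightarrow> (\<forall>S.
     (\<forall>i. VectorSpace.subspace class_ring (S i) (module_vec TYPE(complex) (v i))) \<and>
     (\<forall>h. \<forall>u\<in>S (src h). fst p h *\<^sub>v u \<in> S (tgt h)) \<and>
     (\<forall>i. \<forall>u\<in>S i. snd p i *\<^sub>v u = 0\<^sub>v (w i)) \<longrightarrow>
     (\<forall>i. S i = {0\<^sub>v (v i)}))"

definition Lam_st :: "(int \<Rightarrow> nat) \<Rightarrow> (int \<Rightarrow> nat) \<Rightarrow> (rep \<times> gmat) set" where
  "Lam_st v w = {p \<in> Lam v \<times> homVW v w. stable v w p}"

definition framed_coords :: "(int \<Rightarrow> nat) \<Rightarrow> (int \<Rightarrow> nat) \<Rightarrow> (rep \<times> gmat \<Rightarrow> complex) set" where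
  "framed_coords v w = {(\<lambda>p. \<phi> (fst p)) | \<phi>. \<phi> \<in> rep_coords v} \<union>
     {(\<lambda>p. snd p i $$ (a, b)) | i a b. a < w i \<and> b < v i}"

definition framed_orbit :: "(int \<Rightarrow> nat) \<Rightarrow> rep \<times> gmat \<Rightarrow> (rep \<times> gmat) set" where
  "framed_orbit v p = {framed_act g p | g. g \<in> GV v}"

text \<open>
  \<open>\<L>(v, w)\<close> with its Zariski topology. It is a geometric quotient by a free action, so that this
  topology is the quotient topology; its points are the orbits.
\<close>

definition Lvar :: "(int \<Rightarrow> nat) \<Rightarrow> (int \<Rightarrow> nat) \<Rightarrow> (rep \<times> gmat) set topology" where
  "Lvar v w = quotient_topology
     (subtopology (zariski (framed_coords v w) (E v \<times> homVW v w)) (Lam_st v w))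
     (framed_orbit v)"

definition Xf :: "(int \<Rightarrow> nat) \<Rightarrow> (int \<Rightarrow> nat) \<Rightarrow> (int \<times> int \<Rightarrow> nat) \<Rightarrow> (rep \<times> gmat) set set" where
  "Xf v w f = framed_orbit v ` ((conormal_closure v f \<times> homVW v w) \<inter> Lam_st v w)"

definition w0 :: "int \<Rightarrow> nat" where
  "w0 i = (if i = 0 then 1 else 0)"

section \<open>Young diagrams\<close>

definition young_diagrams :: "nat list set" where
  "young_diagrams = {Y. sorted_wrt (\<ge>) Y \<and> (\<forall>l\<in>set Y. 0 < l)}"

definition A_of :: "nat list \<Rightarrow> (int \<times> int) set" where
  "A_of Y = {(1 - int i, int (Y ! (i - 1)) - int i) | i. 1 \<le> i \<and> i \<le> length Y}"

definition f_of :: "nat list \<Rightarrow> int \<times> int \<Rightarrow> nat" where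
  "f_of Y p = (if p \<in> A_of Y then 1 else 0)"

lemma f_of_unique:
  "{p. f p = 1} = A_of Y \<and> (\<forall>p. p \<notin> A_of Y \<longrightarrow> f p = 0) \<longleftrightarrow> f = f_of Y"
proof
  assume "f = f_of Y"
  then show "{p. f p = 1} = A_of Y \<and> (\<forall>p. p \<notin> A_of Y \<longrightarrow> f p = 0)"
    by (simp add: f_of_def)
next
  assume f: "{p. f p = 1} = A_of Y \<and> (\<forall>p. p \<notin> A_of Y \<longrightarrow> f p = 0)"
  show "f = f_of Y"
  proof
    fix p
    have "p \<in> A_of Y \<Longrightarrow> f p = 1" "p \<notin> A_of Y \<Longrightarrow> f p = 0"
      using f by blast+
    then show "f p = f_of Y p"
      by (simp add: f_of_def)
  qed
qed

definition X_of :: "nat list \<Rightarrow> (rep \<times> gmat) set set" where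
  "X_of Y = Xf (graded_dim (f_of Y)) w0 (f_of Y)"

end

theory Submission
  imports Defs
begin

text \<open>
  The idea is that \<open>\<L>(v, w0)\<close> is a single point if \<open>v\<close> counts the boxes of a Young diagram by content
  (column minus row), and is empty otherwise; the theorem then reduces to finding that point in the
  conormal variety attached to the diagram.

  Let \<open>(x, j)\<close> be stable. Stability says that the covectors obtained from \<open>j\<close> by following paths to
  degree \<open>0\<close> span the dual of every \<open>V\<^sub>d\<close>. The relations \<open>\<psi>\<^sub>i(x) = 0\<close> say that going down and going up
  commute, so the dual of \<open>V\<close> is a quotient of the polynomial ring \<open>\<complex>[X, Y]\<close>, graded by
  \<open>deg X = 1\<close> and \<open>deg Y = - 1\<close>, by a homogeneous ideal. A graded piece of this ring is free of rank one
  over \<open>\<complex>[XY]\<close>, and \<open>XY\<close> acts nilpotently, so the ideal is generated by monomials and is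
  determined by \<open>v\<close>. The monomials outside a monomial ideal are the boxes of a Young diagram,
  and the covectors that they define (\<open>covector\<close>) form a basis in which \<open>(x, j)\<close> takes a normal
  form (\<open>covector_frame_act\<close>) depending only on \<open>v\<close>. That \<open>v\<close> comes from a diagram means that adjacent
  values of \<open>v\<close> differ by at most one, in the direction prescribed by \<open>staircase\<close>
  (\<open>staircase_dimension\<close>, \<open>staircase_young_diagram\<close>).

  The normal form has the boxes as a basis: arrows in \<open>\<Omega>\<close> move a box one step to the left, the opposite
  arrows move it one row up, and the framing reads off the corner box. It is nilpotent because both kinds of
  arrows approach the corner, and stable because some arrow moves any other box closer to the corner
  (\<open>diagram_rep_Lam_st\<close>). Its \<open>\<Omega>\<close>-part is the direct sum of the rows, that is, of the intervals in \<open>A_of Y\<close>.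

  To see that its other part is conormal to the orbit of this sum, consider two consecutive rows. Composing
  the arrows of \<open>\<Omega>\<close> from the degree of the box in the upper row above the last box of the lower row down to the
  degree of the first box of the lower row gives zero on the whole orbit, since no row of the diagram
  meets both degrees: the lower row and those below it do not reach the first of them, the upper row and those
  above it do not reach the last. The matrix entries of this composite are polynomials vanishing on the orbit. The derivative of one
  of them, taken at the direct sum of the rows in the direction \<open>t\<close>, is the sum of the
  entries of \<open>t\<close> leading from the upper to the lower row (\<open>tangent_row_sum_eq_0\<close>), and the sum over all pairs
  of consecutive rows is the pairing of \<open>t\<close> with the second part. So explicit equations of the
  orbit suffice, and its tangent space never has to be computed.
\<close>

section \<open>Linear algebra\<close>

lemma minus_mat_eq_0_iff:
  fixes A B :: "'a :: group_add mat"
  assumes "A \<in> carrier_mat n m" "B \<in> carrier_mat n m"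
  shows "A - B = 0\<^sub>m n m \<longleftrightarrow> A = B"
proof
  assume *: "A - B = 0\<^sub>m n m"
  show "A = B"
  proof (rule eq_matI)
    fix a b assume "a < dim_row B" "b < dim_col B"
    moreover from this have "(A - B) $$ (a, b) = 0"
      using * assms by simp
    ultimately show "A $$ (a, b) = B $$ (a, b)"
      using assms by simp
  qed (use assms in auto)
qed (use assms in auto)

lemma zero_mat_mult_vec:
  fixes u :: "'a :: semiring_0 vec"
  assumes "u \<in> carrier_vec n" shows "0\<^sub>m m n *\<^sub>v u = 0\<^sub>v m"
  using assms by (intro eq_vecI) (auto simp: scalar_prod_def)

lemma empty_mat_eq_0: "A \<in> carrier_mat n m \<Longrightarrow> n = 0 \<or> m = 0 \<Longrightarrow> A = 0\<^sub>m n m"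
  by (intro eq_matI) auto

lemma subspace_module_vecI:
  assumes "S \<subseteq> carrier_vec n" "0\<^sub>v n \<in> S"
    and "\<And>u w. u \<in> S \<Longrightarrow> w \<in> S \<Longrightarrow> u + w \<in> S"
    and "\<And>c u. u \<in> S \<Longrightarrow> c \<cdot>\<^sub>v u \<in> S"
  shows "VectorSpace.subspace class_ring S (module_vec TYPE(complex) n)"
proof -
  interpret vec_space "TYPE(complex)" n .
  show ?thesis
    unfolding VectorSpace.subspace_def submodule_def
    using assms vec_vs vec_module by (auto simp: module_vec_simps)
qed

lemma subspace_module_vec_subset:
  "VectorSpace.subspace class_ring S (module_vec TYPE(complex) n) \<Longrightarrow> S \<subseteq> carrier_vec n"
  unfolding VectorSpace.subspace_def submodule_def by (auto simp: module_vec_simps)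

text \<open>
  Adding zero rows makes the matrix square without changing its kernel, and a square matrix with a
  zero row has determinant zero.
\<close>

lemma wide_matrix_kernel:
  fixes A :: "'a :: field mat"
  assumes A: "A \<in> carrier_mat m n" and mn: "m < n"
  obtains u where "u \<in> carrier_vec n" "u \<noteq> 0\<^sub>v n" "A *\<^sub>v u = 0\<^sub>v m"
proof -
  define B where "B = mat n n (\<lambda>(a, b). if a < m then A $$ (a, b) else 0)"
  have B: "B \<in> carrier_mat n n" by (simp add: B_def)
  have "B\<^sup>T *\<^sub>v unit_vec n (n - 1) = 0\<^sub>v n"
    using mn by (intro eq_vecI) (auto simp: B_def)
  moreover have "unit_vec n (n - 1) \<noteq> (0\<^sub>v n :: 'a vec)"
    using mn by (intro unit_vec_nonzero) auto
  ultimately have "det (B\<^sup>T) = 0"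
    using det_0_iff_vec_prod_zero[of "B\<^sup>T" n] B by (metis transpose_carrier_mat unit_vec_carrier)
  then have "det B = 0"
    using det_transpose[OF B] by simp
  then obtain u where u: "u \<in> carrier_vec n" "u \<noteq> 0\<^sub>v n" "B *\<^sub>v u = 0\<^sub>v n"
    using det_0_iff_vec_prod_zero[OF B] by auto
  have "(A *\<^sub>v u) $ a = 0" if "a < m" for a
  proof -
    have "row A a = row B a"
      using that mn A by (intro eq_vecI) (auto simp: B_def)
    then have "(A *\<^sub>v u) $ a = (B *\<^sub>v u) $ a"
      using that mn A B by auto
    then show ?thesis using u(3) that mn by simp
  qed
  then have "A *\<^sub>v u = 0\<^sub>v m"
    using A by (intro eq_vecI) auto
  with u show ?thesis by (intro that)
qed

lemma invertible_if_injective: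
  fixes A :: "'a :: field mat"
  assumes A: "A \<in> carrier_mat n n"
    and inj: "\<And>u. u \<in> carrier_vec n \<Longrightarrow> A *\<^sub>v u = 0\<^sub>v n \<Longrightarrow> u = 0\<^sub>v n"
  obtains B where "B \<in> carrier_mat n n" "A * B = 1\<^sub>m n" "B * A = 1\<^sub>m n"
proof -
  have "det A \<noteq> 0"
    using det_0_iff_vec_prod_zero[OF A] inj by auto
  then have "A \<in> Units (ring_mat TYPE('a) n ())"
    by (rule det_non_zero_imp_unit[OF A])
  then show ?thesis
    by (auto simp: Units_def ring_mat_simps intro: that)
qed

section \<open>The action of the gauge group\<close>

lemma GV_inverse:
  assumes "g \<in> GV v"
  shows "inv_at g i \<in> carrier_mat (v i) (v i)"
    and "g i * inv_at g i = 1\<^sub>m (v i)" and "inv_at g i * g i = 1\<^sub>m (v i)"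
proof -
  have c: "g i \<in> carrier_mat (v i) (v i)" and "invertible_mat (g i)"
    using assms by (auto simp: GV_def)
  then obtain B where B: "g i * B = 1\<^sub>m (v i)" "B * g i = 1\<^sub>m (dim_row B)"
    unfolding invertible_mat_def inverts_mat_def by auto
  have "dim_col B = v i"
    using B(1) by (metis index_mult_mat(3) index_one_mat(3))
  moreover have "dim_row B = v i"
    using B(2) c by (metis carrier_matD(2) index_mult_mat(3) index_one_mat(3))
  ultimately have Bc: "B \<in> carrier_mat (v i) (v i)" by auto
  have "g i \<in> Units (ring_mat TYPE(complex) (v i) ())"
    using c B Bc by (auto simp: Units_def ring_mat_simps)
  then obtain C where "mat_inverse (g i) = Some C"
    using mat_inverse(1)[OF c, of "()"] by (cases "mat_inverse (g i)") auto
  with mat_inverse(2)[OF c this] show "inv_at g i \<in> carrier_mat (v i) (v i)"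
    "g i * inv_at g i = 1\<^sub>m (v i)" "inv_at g i * g i = 1\<^sub>m (v i)"
    by (auto simp: inv_at_def)
qed

lemma GV_carrier: "g \<in> GV v \<Longrightarrow> g i \<in> carrier_mat (v i) (v i)"
  by (simp add: GV_def)

lemma GV_I:
  assumes "\<And>i. g i \<in> carrier_mat (v i) (v i)" "\<And>i. h i \<in> carrier_mat (v i) (v i)"
    and "\<And>i. g i * h i = 1\<^sub>m (v i)" "\<And>i. h i * g i = 1\<^sub>m (v i)"
  shows "g \<in> GV v"
proof -
  have "invertible_mat (g i)" for i
    unfolding invertible_mat_def inverts_mat_def square_mat.simps
    using assms[of i] by (intro conjI exI[of _ "h i"]) auto
  then show ?thesis using assms(1) by (simp add: GV_def)
qed

lemma inv_at_eqI:
  assumes g: "g \<in> GV v" and h: "h i \<in> carrier_mat (v i) (v i)" and gh: "g i * h i = 1\<^sub>m (v i)"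
  shows "inv_at g i = h i"
proof -
  note c = GV_inverse[OF g, of i] GV_carrier[OF g, of i]
  have "inv_at g i = inv_at g i * (g i * h i)"
    using c gh by simp
  also have "\<dots> = h i"
    using c h by (simp flip: assoc_mult_mat[of _ "v i" "v i" _ "v i" _ "v i"])
  finally show ?thesis .
qed

definition mat_family_mult :: "gmat \<Rightarrow> gmat \<Rightarrow> gmat" where
  "mat_family_mult g h = (\<lambda>i. g i * h i)"

lemma mat_mult_inverse_cancel:
  fixes A :: "complex mat"
  assumes "A \<in> carrier_mat n n" "B \<in> carrier_mat n n" "C \<in> carrier_mat n n" "D \<in> carrier_mat n n"
    and "B * C = 1\<^sub>m n" "A * D = 1\<^sub>m n"
  shows "A * B * (C * D) = 1\<^sub>m n"
proof -
  have "A * B * (C * D) = A * (B * (C * D))"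
    using assms by (intro assoc_mult_mat) auto
  also have "B * (C * D) = B * C * D"
    using assms by (intro assoc_mult_mat[symmetric]) auto
  finally show ?thesis using assms by simp
qed

lemma GV_mult:
  assumes g: "g \<in> GV v" and h: "h \<in> GV v"
  shows "mat_family_mult g h \<in> GV v"
    and "inv_at (mat_family_mult g h) i = inv_at h i * inv_at g i"
proof -
  note c = GV_inverse[OF g] GV_carrier[OF g] GV_inverse[OF h] GV_carrier[OF h]
  have 1: "g i * h i * (inv_at h i * inv_at g i) = 1\<^sub>m (v i)" for i
    by (rule mat_mult_inverse_cancel) (use c in auto)
  have 2: "inv_at h i * inv_at g i * (g i * h i) = 1\<^sub>m (v i)" for i
    by (rule mat_mult_inverse_cancel) (use c in auto)
  have 3: "g i * h i \<in> carrier_mat (v i) (v i)"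
    "inv_at h i * inv_at g i \<in> carrier_mat (v i) (v i)" for i
    using c by (blast intro: mult_carrier_mat)+
  show *: "mat_family_mult g h \<in> GV v"
    unfolding mat_family_mult_def
    by (rule GV_I[of _ _ "\<lambda>i. inv_at h i * inv_at g i"]) (rule 1 2 3)+
  show "inv_at (mat_family_mult g h) i = inv_at h i * inv_at g i"
    by (rule inv_at_eqI[OF *, where h="\<lambda>i. inv_at h i * inv_at g i"])
      (use 1 3 in \<open>simp_all only: mat_family_mult_def\<close>)
qed

lemma GV_inv:
  assumes g: "g \<in> GV v"
  shows "inv_at g \<in> GV v"
  by (rule GV_I[of _ _ g]) (rule GV_inverse[OF g] GV_carrier[OF g])+

lemma GV_one: "(\<lambda>i. 1\<^sub>m (v i)) \<in> GV v" "inv_at (\<lambda>i. 1\<^sub>m (v i)) i = 1\<^sub>m (v i)"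
proof -
  show *: "(\<lambda>i. 1\<^sub>m (v i)) \<in> GV v"
    by (rule GV_I[of _ _ "\<lambda>i. 1\<^sub>m (v i)"]) simp_all
  show "inv_at (\<lambda>i. 1\<^sub>m (v i)) i = 1\<^sub>m (v i)"
    by (rule inv_at_eqI[OF *, where h="\<lambda>i. 1\<^sub>m (v i)"]) simp_all
qed

lemma rep_act_one:
  assumes "x \<in> E v" shows "rep_act (\<lambda>i. 1\<^sub>m (v i)) x = x"
proof
  fix h
  have "x h \<in> carrier_mat (v (tgt h)) (v (src h))"
    using assms by (simp add: E_def)
  then show "rep_act (\<lambda>i. 1\<^sub>m (v i)) x h = x h"
    by (simp add: rep_act_def GV_one(2))
qed

lemma rep_act_carrier:
  assumes "g \<in> GV v" "x \<in> E v" shows "rep_act g x \<in> E v"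
proof -
  have "x h \<in> carrier_mat (v (tgt h)) (v (src h))" for h
    using assms by (simp add: E_def)
  then show ?thesis
    using GV_inverse(1)[OF assms(1)] GV_carrier[OF assms(1)]
    by (auto simp: rep_act_def E_def intro!: mult_carrier_mat[where n="v _"])
qed

lemma framed_act_mult:
  assumes g: "g \<in> GV v" and h: "h \<in> GV v" and p: "p \<in> E v \<times> homVW v w"
  shows "framed_act g (framed_act h p) = framed_act (mat_family_mult g h) p"
proof -
  note c = GV_inverse(1)[OF g] GV_carrier[OF g] GV_inverse(1)[OF h] GV_carrier[OF h]
  have x: "fst p a \<in> carrier_mat (v (tgt a)) (v (src a))" for a
    using p by (auto simp: E_def)
  have j: "snd p i \<in> carrier_mat (w i) (v i)" for i
    using p by (auto simp: homVW_def)
  have "g (tgt a) * (h (tgt a) * fst p a * inv_at h (src a)) * inv_at g (src a) =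
    g (tgt a) * h (tgt a) * fst p a * (inv_at h (src a) * inv_at g (src a))" for a
  proof -
    let ?t = "v (tgt a)" and ?s = "v (src a)"
    have m: "h (tgt a) * fst p a \<in> carrier_mat ?t ?s" "fst p a * inv_at h (src a) \<in> carrier_mat ?t ?s"
      "g (tgt a) * h (tgt a) * fst p a \<in> carrier_mat ?t ?s" "g (tgt a) * h (tgt a) \<in> carrier_mat ?t ?t"
      using c x by (auto intro!: mult_carrier_mat[where n="v _"])
    note assoc = assoc_mult_mat[OF c(2) c(4) x] assoc_mult_mat[OF c(4) x c(3)]
      assoc_mult_mat[OF c(2) m(1) c(3)] assoc_mult_mat[OF c(2) c(4) m(2)]
      assoc_mult_mat[OF m(4) x c(3)] assoc_mult_mat[OF m(3) c(3) c(1)]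
    show ?thesis
      using assoc by metis
  qed
  moreover have "snd p i * inv_at h i * inv_at g i = snd p i * (inv_at h i * inv_at g i)" for i
    using c j by (subst assoc_mult_mat[of _ "w i" "v i" _ "v i" _ "v i"]) auto
  ultimately show ?thesis
    unfolding framed_act_def rep_act_def GV_mult(2)[OF g h]
    by (simp only: mat_family_mult_def fst_conv snd_conv)
qed

lemma framed_orbit_act:
  assumes g: "g \<in> GV v" and p: "p \<in> E v \<times> homVW v w"
  shows "framed_orbit v (framed_act g p) = framed_orbit v p"
proof -
  have "framed_act h (framed_act g p) \<in> framed_orbit v p" if "h \<in> GV v" for h
    using framed_act_mult[OF that g p] GV_mult(1)[OF that g] by (auto simp: framed_orbit_def)
  moreover have "framed_act h p \<in> framed_orbit v (framed_act g p)" if h: "h \<in> GV v" for h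
  proof -
    have "mat_family_mult (mat_family_mult h (inv_at g)) g = h"
    proof
      fix i
      show "mat_family_mult (mat_family_mult h (inv_at g)) g i = h i"
        using GV_inverse[OF g, of i] GV_carrier[OF g, of i] GV_carrier[OF h, of i]
          assoc_mult_mat[of "h i" "v i" "v i" "inv_at g i" "v i" "g i" "v i"]
        by (simp add: mat_family_mult_def)
    qed
    then have "framed_act h p = framed_act (mat_family_mult h (inv_at g)) (framed_act g p)"
      using framed_act_mult[OF GV_mult(1)[OF h GV_inv[OF g]] g p] by simp
    then show ?thesis
      using GV_mult(1)[OF h GV_inv[OF g]] by (auto simp: framed_orbit_def)
  qed
  ultimately show ?thesis
    by (auto simp: framed_orbit_def)
qed

section \<open>The point of a Young diagram\<close>

lemma arrows_into: "{h. tgt h = i} = {Down (i + 1), Up i}"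
proof (rule Set.set_eqI)
  fix h show "h \<in> {h. tgt h = i} \<longleftrightarrow> h \<in> {Down (i + 1), Up i}"
    by (cases h) auto
qed

lemma Omega_simps [simp]: "Down d \<in> Omega" "Up d \<notin> Omega"
  by (auto simp: Omega_def)

lemma eps_simps [simp]: "eps (Down d) = 1" "eps (Up d) = - 1"
  by (auto simp: eps_def Omega_def)

lemma psi_eq_0_iff:
  assumes x: "x \<in> E v"
  shows "psi v i x = 0\<^sub>m (v i) (v i) \<longleftrightarrow> x (Down (i + 1)) * x (Up (i + 1)) = x (Up i) * x (Down i)"
proof -
  have c: "x (Down d) \<in> carrier_mat (v (d - 1)) (v d)" "x (Up d) \<in> carrier_mat (v d) (v (d - 1))" for d
    using x unfolding E_def by (metis (mono_tags) mem_Collect_eq src.simps tgt.simps)+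
  have "psi v i x = x (Down (i + 1)) * x (Up (i + 1)) - x (Up i) * x (Down i)"
    using c(1)[of "i + 1"] c(2)[of "i + 1"] c[of i]
    by (intro eq_matI) (auto simp: psi_def arrows_into)
  moreover have "x (Down (i + 1)) * x (Up (i + 1)) \<in> carrier_mat (v i) (v i)"
    "x (Up i) * x (Down i) \<in> carrier_mat (v i) (v i)"
    using c(1)[of "i + 1"] c(2)[of "i + 1"] c[of i] by auto
  ultimately show ?thesis
    using minus_mat_eq_0_iff by metis
qed

text \<open>
  The condition on \<open>v\<close> to count the boxes of a Young diagram by content: the diagonal of content \<open>d\<close> of the
  diagram gains or keeps boxes as \<open>d\<close> moves towards \<open>0\<close>, and at most one box per step.
\<close>

definition staircase :: "(int \<Rightarrow> nat) \<Rightarrow> bool" where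
  "staircase v \<longleftrightarrow>
     (\<forall>d\<ge>1. v d \<le> v (d - 1) \<and> v (d - 1) \<le> Suc (v d)) \<and>
     (\<forall>d\<le>0. v (d - 1) \<le> v d \<and> v d \<le> Suc (v (d - 1)))"

lemma staircaseD:
  assumes "staircase v"
  shows "1 \<le> d \<Longrightarrow> v d \<le> v (d - 1)" "1 \<le> d \<Longrightarrow> v (d - 1) \<le> Suc (v d)"
    "d \<le> 0 \<Longrightarrow> v (d - 1) \<le> v d" "d \<le> 0 \<Longrightarrow> v d \<le> Suc (v (d - 1))"
  using assms by (auto simp: staircase_def)

text \<open>
  The basis vector with index \<open>a\<close> in degree \<open>d\<close> stands for the box on the diagonal of content \<open>d\<close> at distance
  \<open>a\<close> from its first box, that is, for row \<open>a + max 0 (- d)\<close> and column \<open>a + max 0 d\<close>, counted from zero.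
  The relation holds if the arrow takes the box with index \<open>b\<close> in its source to the box with index \<open>a\<close> in
  its target. An arrow in \<open>\<Omega>\<close> moves a box to the left and an opposite arrow moves it up, whence
  the distinction by the side of degree \<open>0\<close> on which the arrow lies.
\<close>

fun diagram_step :: "arrow \<Rightarrow> nat \<Rightarrow> nat \<Rightarrow> bool" where
  "diagram_step (Down d) a b \<longleftrightarrow> (if 1 \<le> d then a = b else Suc a = b)"
| "diagram_step (Up d) a b \<longleftrightarrow> (if 1 \<le> d then Suc a = b else a = b)"

definition diagram_rep :: "(int \<Rightarrow> nat) \<Rightarrow> rep" where
  "diagram_rep v h = mat (v (tgt h)) (v (src h)) (\<lambda>(a, b). if diagram_step h a b then 1 else 0)"

definition diagram_framing :: "(int \<Rightarrow> nat) \<Rightarrow> gmat" where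
  "diagram_framing v i = mat (w0 i) (v i) (\<lambda>(a, b). if b = 0 then 1 else 0)"

lemma diagram_rep_carrier: "diagram_rep v \<in> E v"
  by (simp add: diagram_rep_def E_def)

lemma diagram_rep_dim [simp]:
  "dim_row (diagram_rep v h) = v (tgt h)" "dim_col (diagram_rep v h) = v (src h)"
  by (simp_all add: diagram_rep_def)

lemma diagram_framing_carrier: "diagram_framing v \<in> homVW v w0"
  by (simp add: diagram_framing_def homVW_def)

lemma diagram_rep_mult_vec:
  assumes u: "u \<in> carrier_vec (v (src h))" and ab: "a < v (tgt h)" "b < v (src h)" "diagram_step h a b"
  shows "(diagram_rep v h *\<^sub>v u) $ a = u $ b"
proof -
  have "(diagram_rep v h *\<^sub>v u) $ a = (\<Sum>c\<in>{0..<v (src h)}. (if diagram_step h a c then 1 else 0) * u $ c)"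
    using u ab(1) by (simp add: scalar_prod_def diagram_rep_def)
  also have "\<dots> = (\<Sum>c\<in>{0..<v (src h)}. if c = b then u $ c else 0)"
    using ab(3) by (intro sum.cong) (cases h; auto split: if_splits)+
  also have "\<dots> = u $ b"
    using ab(2) by simp
  finally show ?thesis .
qed

lemma diagram_rep_mult_entry:
  assumes "A \<in> carrier_mat (v (src h)) n" and ab: "a < v (tgt h)" "c < n"
    and step: "diagram_step h a b"
  shows "(diagram_rep v h * A) $$ (a, c) = (if b < v (src h) then A $$ (b, c) else 0)"
proof -
  have "(diagram_rep v h * A) $$ (a, c) = (\<Sum>k\<in>{0..<v (src h)}. (if diagram_step h a k then 1 else 0) * A $$ (k, c))"
    using assms(1) ab by (simp add: scalar_prod_def diagram_rep_def)
  also have "\<dots> = (\<Sum>k\<in>{0..<v (src h)}. if k = b then A $$ (k, c) else 0)"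
    using step by (intro sum.cong) (cases h; auto split: if_splits)+
  also have "\<dots> = (if b < v (src h) then A $$ (b, c) else 0)"
    by simp
  finally show ?thesis .
qed

lemma diagram_rep_no_step:
  assumes "A \<in> carrier_mat (v (src h)) n" and ab: "a < v (tgt h)" "c < n"
    and step: "\<And>b. \<not> diagram_step h a b"
  shows "(diagram_rep v h * A) $$ (a, c) = 0"
  using assms by (simp add: scalar_prod_def diagram_rep_def)

text \<open>
  Both composites move a box diagonally by one towards the corner. The staircase inequalities ensure that the
  intermediate box exists as soon as the two others do.
\<close>

lemma diagram_rep_preprojective:
  assumes v: "staircase v"
  shows "diagram_rep v (Down (i + 1)) * diagram_rep v (Up (i + 1)) =
    diagram_rep v (Up i) * diagram_rep v (Down i)"
proof (rule eq_matI)
  fix a c assume ac: "a < dim_row (diagram_rep v (Up i) * diagram_rep v (Down i))"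
    "c < dim_col (diagram_rep v (Up i) * diagram_rep v (Down i))"
  then have ac: "a < v i" "c < v i" by auto
  have U: "diagram_rep v (Up (i + 1)) \<in> carrier_mat (v (src (Down (i + 1)))) (v i)"
    and D: "diagram_rep v (Down i) \<in> carrier_mat (v (src (Up i))) (v i)"
    by auto
  have s: "i \<ge> 0 \<Longrightarrow> v (i + 1) \<le> v i \<and> v i \<le> Suc (v (i + 1))"
    "i \<ge> 1 \<Longrightarrow> v i \<le> v (i - 1) \<and> v (i - 1) \<le> Suc (v i)"
    "i \<le> 0 \<Longrightarrow> v (i - 1) \<le> v i \<and> v i \<le> Suc (v (i - 1))"
    "i < 0 \<Longrightarrow> v i \<le> v (i + 1) \<and> v (i + 1) \<le> Suc (v i)"
    using staircaseD[OF v, of i] staircaseD[OF v, of "i + 1"] by auto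
  show "(diagram_rep v (Down (i + 1)) * diagram_rep v (Up (i + 1))) $$ (a, c) =
    (diagram_rep v (Up i) * diagram_rep v (Down i)) $$ (a, c)"
  proof -
    note entryD = diagram_rep_mult_entry[where v=v and h="Down (i + 1)" and n="v i" and a=a and c=c, OF U]
    note entryU = diagram_rep_mult_entry[where v=v and h="Up i" and n="v i" and a=a and c=c, OF D]
    consider "1 \<le> i" | "i = 0" | "i < 0" by linarith
    then show ?thesis
    proof cases
      case 1
      then show ?thesis
        using entryD[of a] entryU[of "Suc a"] ac s by (simp add: diagram_rep_def)
    next
      case 2
      then show ?thesis
        using entryD[of a] entryU[of a] ac s by (simp add: diagram_rep_def)
    next
      case 3
      then show ?thesis
        using entryD[of "Suc a"] entryU[of a] ac s by (simp add: diagram_rep_def)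
    qed
  qed
qed (use assms in auto)

text \<open>
  The coordinates of a vector in a destabilizing subspace vanish by induction on the distance of the box to
  the corner.
\<close>

lemma diagram_rep_stable:
  assumes v: "staircase v"
  shows "stable v w0 (diagram_rep v, diagram_framing v)"
  unfolding stable_def fst_conv snd_conv
proof (intro allI impI, elim conjE)
  fix S d
  assume S: "\<forall>i. VectorSpace.subspace class_ring (S i) (module_vec TYPE(complex) (v i))"
    and x: "\<forall>h. \<forall>u\<in>S (src h). diagram_rep v h *\<^sub>v u \<in> S (tgt h)"
    and j: "\<forall>i. \<forall>u\<in>S i. diagram_framing v i *\<^sub>v u = 0\<^sub>v (w0 i)"
  have Sc: "u \<in> carrier_vec (v i)" if "u \<in> S i" for u i
    using subspace_module_vec_subset[of "S i" "v i"] S that by auto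
  have s: "d \<ge> 1 \<Longrightarrow> v d \<le> v (d - 1)" "d \<le> 0 \<Longrightarrow> v d \<le> Suc (v (d - 1))"
    "d < 0 \<Longrightarrow> v d \<le> v (d + 1)" for d
    using staircaseD[OF v, of d] staircaseD[OF v, of "d + 1"] by auto
  \<comment> \<open>Every box other than the corner box can be moved towards the corner by one of the arrows.\<close>
  have "u $ a = 0" if "u \<in> S d" "a < v d" for u a d
    using that
  proof (induction "2 * a + nat \<bar>d\<bar>" arbitrary: u a d rule: less_induct)
    case less
    note u = Sc[OF less.prems(1)]
    consider "d \<ge> 1" | "d < 0" | "d = 0" "a > 0" | "d = 0" "a = 0" by linarith
    then show ?case
    proof cases
      case 1
      then have "(diagram_rep v (Down d) *\<^sub>v u) $ a = u $ a"
        using u less.prems s(1)[of d] by (intro diagram_rep_mult_vec) auto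
      moreover have "(diagram_rep v (Down d) *\<^sub>v u) $ a = 0"
        using 1 less.prems s(1)[of d] x[rule_format, of u "Down d"]
        by (intro less.hyps[of a "d - 1"]) auto
      ultimately show ?thesis by simp
    next
      case 2
      then have "(diagram_rep v (Up (d + 1)) *\<^sub>v u) $ a = u $ a"
        using u less.prems s(3)[of d] by (intro diagram_rep_mult_vec) auto
      moreover have "(diagram_rep v (Up (d + 1)) *\<^sub>v u) $ a = 0"
        using 2 less.prems s(3)[of d] x[rule_format, of u "Up (d + 1)"]
        by (intro less.hyps[of a "d + 1"]) auto
      ultimately show ?thesis by simp
    next
      case 3
      then have "(diagram_rep v (Down d) *\<^sub>v u) $ (a - 1) = u $ a"
        using u less.prems s(2)[of d] by (intro diagram_rep_mult_vec) auto
      moreover have "(diagram_rep v (Down d) *\<^sub>v u) $ (a - 1) = 0"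
        using 3 less.prems s(2)[of d] x[rule_format, of u "Down d"]
        by (intro less.hyps[of "a - 1" "d - 1"]) auto
      ultimately show ?thesis by simp
    next
      case 4
      have "(diagram_framing v 0 *\<^sub>v u) $ 0 = (\<Sum>b\<in>{0..<v 0}. (if b = 0 then 1 else 0) * u $ b)"
        using u 4 by (simp add: diagram_framing_def w0_def scalar_prod_def)
      also have "\<dots> = (\<Sum>b\<in>{0..<v 0}. if b = 0 then u $ b else 0)"
        by (intro sum.cong) auto
      also have "\<dots> = u $ 0"
        using less.prems 4 by simp
      finally show ?thesis
        using j[rule_format, of u 0] less.prems 4 by (simp add: w0_def)
    qed
  qed
  then have "u = 0\<^sub>v (v d)" if "u \<in> S d" for u
    using Sc[OF that] that by (intro eq_vecI) auto
  moreover have "0\<^sub>v (v d) \<in> S d"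
    using S[rule_format, of d] unfolding VectorSpace.subspace_def submodule_def
    by (auto simp: module_vec_simps)
  ultimately show "S d = {0\<^sub>v (v d)}"
    by blast
qed

text \<open>
  Every arrow decreases the distance of a box to the corner box, which is row plus column and equals
  \<open>2 * a + \<bar>d\<bar>\<close> for index \<open>a\<close> in degree \<open>d\<close>. This bounds the length of the nonzero paths.
\<close>

lemma diagram_step_weight:
  assumes "diagram_step h a b"
  shows "2 * b + nat \<bar>src h\<bar> = Suc (2 * a + nat \<bar>tgt h\<bar>)"
  using assms by (cases h) (auto split: if_splits)

lemma diagram_rep_path_weight:
  assumes hs: "composable hs" "hs \<noteq> []" and ab: "a < v (tgt (hd hs))" "b < v (src (last hs))"
    and nz: "path_map v (diagram_rep v) hs $$ (a, b) \<noteq> 0"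
  shows "2 * b + nat \<bar>src (last hs)\<bar> = 2 * a + nat \<bar>tgt (hd hs)\<bar> + length hs"
proof -
  let ?P = "\<lambda>hs. foldr (\<lambda>h A. diagram_rep v h * A) hs (1\<^sub>m (v (src (last hs))))"
  have "?P hs \<in> carrier_mat (v (tgt (hd hs))) (v (src (last hs))) \<and>
    (\<forall>a < v (tgt (hd hs)). ?P hs $$ (a, b) \<noteq> 0 \<longrightarrow> 
      2 * b + nat \<bar>src (last hs)\<bar> = 2 * a + nat \<bar>tgt (hd hs)\<bar> + length hs)"
    using hs ab(2)
  proof (induction hs)
    case (Cons h hs)
    show ?case
    proof (cases "hs = []")
      case True
      then show ?thesis
        using Cons.prems diagram_step_weight[of h _ b]
        by (auto simp: diagram_rep_def split: if_splits)
    next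
      case False
      then have c: "composable hs" "src h = tgt (hd hs)"
        using Cons.prems(1) by (auto simp: composable_def neq_Nil_conv)
      note IH = Cons.IH[OF c(1) False]
      let ?A = "?P hs"
      have A: "?A \<in> carrier_mat (v (src h)) (v (src (last hs)))"
        using IH c False Cons.prems by auto
      have "2 * b + nat \<bar>src (last (h # hs))\<bar> = 2 * a + nat \<bar>tgt h\<bar> + length (h # hs)"
        if a: "a < v (tgt h)" and nz: "(diagram_rep v h * ?A) $$ (a, b) \<noteq> 0" for a
      proof -
        obtain k where k: "diagram_step h a k"
          using diagram_rep_no_step[OF A a] nz Cons.prems(3) False by auto
        have "k < v (src h)" "?A $$ (k, b) \<noteq> 0"
          using diagram_rep_mult_entry[OF A a _ k, of b] nz Cons.prems(3) False
          by (auto split: if_splits)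
        then show ?thesis
          using IH c Cons.prems(3) False diagram_step_weight[OF k] by auto
      qed
      then show ?thesis
        using A False by auto
    qed
  qed simp
  then show ?thesis
    using ab nz by (simp add: path_map_def)
qed

lemma diagram_rep_nilpotent:
  assumes v: "v \<in> graded_dims"
  shows "nilpotent_rep v (diagram_rep v)"
proof -
  define N where "N = Suc (\<Sum>i | v i \<noteq> 0. 2 * v i + nat \<bar>i\<bar>)"
  have N: "2 * b + nat \<bar>i\<bar> < N" if "b < v i" for b i
  proof -
    have "2 * v i + nat \<bar>i\<bar> \<le> (\<Sum>i | v i \<noteq> 0. 2 * v i + nat \<bar>i\<bar>)"
      using v that by (intro member_le_sum) (auto simp: graded_dims_def)
    then show ?thesis using that by (simp add: N_def)
  qed
  have "path_map v (diagram_rep v) hs = 0\<^sub>m (v (tgt (hd hs))) (v (src (last hs)))"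
    if hs: "length hs = N" "composable hs" for hs
  proof -
    have "hs \<noteq> []" using hs by (auto simp: N_def)
    have "path_map v x hs \<in> carrier_mat (v (tgt (hd hs))) (v (src (last hs)))"
      if "x \<in> E v" "composable hs" "hs \<noteq> []" for x hs
      using that(2,3) that(1)
    proof (induction hs)
      case (Cons h hs)
      then show ?case
        by (cases "hs = []") (auto simp: path_map_def composable_def E_def neq_Nil_conv
            intro!: mult_carrier_mat[where n="v (src h)"])
    qed simp
    from this[OF diagram_rep_carrier hs(2) \<open>hs \<noteq> []\<close>] show ?thesis
      using diagram_rep_path_weight[OF hs(2) \<open>hs \<noteq> []\<close>] N[of _ "src (last hs)"] hs(1)
      by (intro eq_matI) (auto, fastforce)
  qed
  then show ?thesis
    unfolding nilpotent_rep_def by (intro exI[of _ N]) (auto simp: N_def)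
qed

lemma diagram_rep_Lam_st:
  assumes "v \<in> graded_dims" "staircase v"
  shows "(diagram_rep v, diagram_framing v) \<in> Lam_st v w0"
  using diagram_rep_nilpotent[OF assms(1)] diagram_rep_stable[OF assms(2)]
    diagram_rep_preprojective[OF assms(2)]
  by (simp add: Lam_st_def Lam_def diagram_rep_carrier diagram_framing_carrier psi_eq_0_iff)

section \<open>Every stable point is the point of a Young diagram\<close>

text \<open>
  The covectors on \<open>V\<^sub>0\<close> given by \<open>j\<close> after \<open>a\<close> excursions to degree \<open>- 1\<close> and back. They correspond to the
  monomials \<open>(XY)\<^sup>a\<close>.
\<close>

primrec corner_covector :: "rep \<Rightarrow> gmat \<Rightarrow> nat \<Rightarrow> complex mat" where
  "corner_covector x j 0 = j 0"
| "corner_covector x j (Suc a) = corner_covector x j a * (x (Up 0) * x (Down 0))"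

primrec right_covector :: "rep \<Rightarrow> gmat \<Rightarrow> nat \<Rightarrow> nat \<Rightarrow> complex mat" where
  "right_covector x j a 0 = corner_covector x j a"
| "right_covector x j a (Suc n) = right_covector x j a n * x (Down (1 + int n))"

primrec left_covector :: "rep \<Rightarrow> gmat \<Rightarrow> nat \<Rightarrow> nat \<Rightarrow> complex mat" where
  "left_covector x j a 0 = corner_covector x j a"
| "left_covector x j a (Suc n) = left_covector x j a n * x (Up (- int n))"

text \<open>
  The covectors on \<open>V\<^sub>d\<close> that correspond to the monomial \<open>(XY)\<^sup>a\<close> times the power of \<open>X\<close> or \<open>Y\<close> of degree \<open>d\<close>,
  that is, to the box with index \<open>a\<close> in degree \<open>d\<close>.
\<close>

definition covector :: "rep \<Rightarrow> gmat \<Rightarrow> int \<Rightarrow> nat \<Rightarrow> complex mat" where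
  "covector x j d a = (if 0 \<le> d then right_covector x j a (nat d) else left_covector x j a (nat (- d)))"

lemma covector_zero: "covector x j 0 a = corner_covector x j a"
  by (simp add: covector_def)

lemma covector_Down_right:
  assumes "1 \<le> d" shows "covector x j (d - 1) a * x (Down d) = covector x j d a"
proof -
  obtain n where "d = 1 + int n"
    using zle_iff_zadd[of 1 d] assms by auto
  then show ?thesis
    by (simp add: covector_def nat_add_distrib)
qed

lemma covector_Up_left:
  assumes "d \<le> 0" shows "covector x j d a * x (Up d) = covector x j (d - 1) a"
proof -
  obtain n where "d = - int n"
    using zle_iff_zadd[of 0 "- d"] assms by (metis add_0 minus_minus neg_0_le_iff_le)
  moreover have "covector x j (- int n) a = left_covector x j a n"
    unfolding covector_def by (cases "n = 0") auto
  moreover have "covector x j (- int n - 1) a = left_covector x j a (Suc n)"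
  proof -
    have "nat (- (- int n - 1)) = Suc n" by linarith
    then show ?thesis unfolding covector_def by (simp del: minus_diff_eq)
  qed
  ultimately show ?thesis
    by simp
qed

context
  fixes v :: "int \<Rightarrow> nat" and x :: rep and j :: gmat
  assumes x: "x \<in> Lam v" and j: "j \<in> homVW v w0"
begin

lemma Down_carrier: "x (Down d) \<in> carrier_mat (v (d - 1)) (v d)"
  and Up_carrier: "x (Up d) \<in> carrier_mat (v d) (v (d - 1))"
  using x by (auto simp: Lam_def E_def dest: spec[of _ "Down d"] spec[of _ "Up d"])

lemma preprojective: "x (Down (i + 1)) * x (Up (i + 1)) = x (Up i) * x (Down i)"
  using x psi_eq_0_iff[of x v i] by (simp add: Lam_def)

lemma Up_Down_carrier: "x (Up d) * x (Down d) \<in> carrier_mat (v d) (v d)"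
  using Up_carrier Down_carrier by (rule mult_carrier_mat)

lemma covector_carrier: "covector x j d a \<in> carrier_mat 1 (v d)"
proof -
  have 0: "corner_covector x j a \<in> carrier_mat 1 (v 0)" for a
  proof (induction a)
    case 0
    have "j 0 \<in> carrier_mat (w0 0) (v 0)"
      using j unfolding homVW_def by blast
    then show ?case by (simp add: w0_def)
  next
    case (Suc a)
    then show ?case using Up_Down_carrier[of 0] by simp
  qed
  show ?thesis
  proof (cases "0 \<le> d")
    case True
    then show ?thesis
    proof (induction d rule: int_ge_induct)
      case base
      then show ?case using 0 by (simp add: covector_zero)
    next
      case (step d)
      then show ?case
        using covector_Down_right[of "d + 1" x j a]
          mult_carrier_mat[of "covector x j d a" 1 "v d" "x (Down (d + 1))" "v (d + 1)"]
          Down_carrier[of "d + 1"] by simp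
    qed
  next
    case False
    then have "d \<le> 0" by simp
    then show ?thesis
    proof (induction d rule: int_le_induct)
      case base
      then show ?case using 0 by (simp add: covector_zero)
    next
      case (step d)
      then show ?case
        using covector_Up_left[of d x j a]
          mult_carrier_mat[of "covector x j d a" 1 "v d" "x (Up d)" "v (d - 1)"]
          Up_carrier[of d] by simp
    qed
  qed
qed

lemma covector_zero_Suc: "covector x j 0 a * (x (Up 0) * x (Down 0)) = covector x j 0 (Suc a)"
  by (simp add: covector_zero)

lemma covector_Down_left:
  "d \<le> 0 \<Longrightarrow> covector x j (d - 1) a * x (Down d) = covector x j d (Suc a)"
proof (induction d rule: int_le_induct)
  case base
  have "covector x j (0 - 1) a * x (Down 0) = covector x j 0 a * x (Up 0) * x (Down 0)"
    using covector_Up_left[of 0 x j a] by simp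
  then show ?case
    using assoc_mult_mat[OF covector_carrier Up_carrier Down_carrier] covector_zero_Suc by simp
next
  case (step d)
  let ?r = "covector x j (d - 1) a"
  have "covector x j (d - 1 - 1) a * x (Down (d - 1)) = ?r * x (Up (d - 1)) * x (Down (d - 1))"
    using covector_Up_left[of "d - 1" x j a] step by simp
  also have "\<dots> = ?r * (x (Up (d - 1)) * x (Down (d - 1)))"
    by (rule assoc_mult_mat[OF covector_carrier Up_carrier Down_carrier])
  also have "\<dots> = ?r * (x (Down d) * x (Up d))"
    using preprojective[of "d - 1"] by simp
  also have "\<dots> = ?r * x (Down d) * x (Up d)"
    by (rule assoc_mult_mat[OF covector_carrier Down_carrier Up_carrier, symmetric])
  also have "\<dots> = covector x j (d - 1) (Suc a)"
    using step covector_Up_left by simp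
  finally show ?case .
qed

lemma covector_Up_right:
  "1 \<le> d \<Longrightarrow> covector x j d a * x (Up d) = covector x j (d - 1) (Suc a)"
proof (induction d rule: int_ge_induct)
  case base
  have "covector x j 1 a * x (Up 1) = covector x j 0 a * x (Down 1) * x (Up 1)"
    using covector_Down_right[of 1 x j a] by simp
  also have "\<dots> = covector x j 0 a * (x (Down 1) * x (Up 1))"
    using assoc_mult_mat[OF covector_carrier[of "1 - 1"] Down_carrier[of 1] Up_carrier[of 1]] by simp
  also have "\<dots> = covector x j 0 (Suc a)"
    using preprojective[of 0] covector_zero_Suc by simp
  finally show ?case by simp
next
  case (step d)
  let ?r = "covector x j d a"
  have "covector x j (d + 1) a * x (Up (d + 1)) = ?r * x (Down (d + 1)) * x (Up (d + 1))"
    using covector_Down_right[of "d + 1" x j a] step by simp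
  also have "\<dots> = ?r * (x (Down (d + 1)) * x (Up (d + 1)))"
    using assoc_mult_mat[OF covector_carrier[of "d + 1 - 1"] Down_carrier[of "d + 1"] Up_carrier[of "d + 1"]] by simp
  also have "\<dots> = ?r * (x (Up d) * x (Down d))"
    by (simp only: preprojective)
  also have "\<dots> = ?r * x (Up d) * x (Down d)"
    by (rule assoc_mult_mat[OF covector_carrier Up_carrier Down_carrier, symmetric])
  also have "\<dots> = covector x j (d + 1 - 1) (Suc a)"
    using step covector_Down_right[of d x j "Suc a"] by simp
  finally show ?case .
qed

text \<open>
  The transposed arrows move the covectors as they move the boxes of the infinite quadrant, away from the
  corner. If they lead away from degree \<open>0\<close> this is the definition; otherwise it is the
  commutation of down and up, propagated by induction on the distance to degree \<open>0\<close>.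
\<close>

lemma covector_mult:
  assumes "diagram_step h a b"
  shows "covector x j (tgt h) a * x h = covector x j (src h) b"
  using assms covector_Down_right covector_Down_left covector_Up_left covector_Up_right
  by (cases h) (auto split: if_splits)

text \<open>
  Multiplication by \<open>XY\<close>.
\<close>

lemma covector_Suc:
  "covector x j d a * (x (Up d) * x (Down d)) = covector x j d (Suc a)"
proof -
  have "covector x j d a * x (Up d) * x (Down d) = covector x j d (Suc a)"
    using covector_Up_right[of d a] covector_Down_right[of d x j "Suc a"]
      covector_Up_left[of d x j a] covector_Down_left[of d a] by (cases "1 \<le> d") auto
  then show ?thesis
    using assoc_mult_mat[OF covector_carrier Up_carrier Down_carrier] by simp
qed

text \<open>
  The covector with index \<open>a\<close> in degree \<open>0\<close> involves a path of length \<open>2 * a\<close> based at degree \<open>0\<close>, which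
  vanishes for large \<open>a\<close> by nilpotency; the other covectors are obtained from these by further multiplications.
\<close>

lemma covector_eventually_zero: "\<exists>N. \<forall>d. \<forall>a\<ge>N. covector x j d a = 0\<^sub>m 1 (v d)"
proof -
  obtain N where N: "N \<ge> 1" and path: "\<And>hs. length hs = N \<Longrightarrow> composable hs \<Longrightarrow>
      path_map v x hs = 0\<^sub>m (v (tgt (hd hs))) (v (src (last hs)))"
    using x unfolding Lam_def nilpotent_rep_def by auto
  \<comment> \<open>The path starting in degree \<open>0\<close> that goes back and forth along one edge.\<close>
  define zigzag where "zigzag = rec_nat [] (\<lambda>n hs. (if even n then Down 0 else Up 0) # hs)"
  have zigzag: "zigzag 0 = []" "zigzag (Suc n) = (if even n then Down 0 else Up 0) # zigzag n" for n
    by (simp_all add: zigzag_def)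
  have hd: "n > 0 \<Longrightarrow> hd (zigzag n) = (if even n then Up 0 else Down 0)" for n
    by (cases n) (auto simp: zigzag)
  have len: "length (zigzag n) = n" for n
    by (induction n) (auto simp: zigzag)
  have last: "n > 0 \<Longrightarrow> last (zigzag n) = Down 0" for n
  proof (induction n)
    case (Suc n)
    then show ?case using len[of n] by (cases n) (auto simp: zigzag)
  qed simp
  have comp: "composable (zigzag n)" for n
  proof (induction n)
    case (Suc n)
    show ?case
    proof (cases n)
      case (Suc m)
      with \<open>composable (zigzag n)\<close> show ?thesis
        by (auto simp: composable_def zigzag)
    qed (simp add: zigzag composable_def)
  qed (simp add: zigzag composable_def)
  define P where "P n = foldr (\<lambda>h A. x h * A) (zigzag n) (1\<^sub>m (v 0))" for n
  have Pc: "P n \<in> carrier_mat (v (if even n then 0 else - 1)) (v 0)" for n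
    using Up_carrier[of 0] Down_carrier[of 0]
    by (induction n) (auto simp: P_def zigzag intro!: mult_carrier_mat[where n="v _"])
  have PN: "P N = 0\<^sub>m (v (if even N then 0 else - 1)) (v 0)"
    using path[OF len comp] N hd[of N] last[of N] by (auto simp: P_def path_map_def)
  have "n \<ge> N \<Longrightarrow> P n = 0\<^sub>m (v (if even n then 0 else - 1)) (v 0)" for n
  proof (induction n rule: dec_induct)
    case base
    show ?case by (rule PN)
  next
    case (step n)
    then show ?case
      using Up_carrier[of 0] Down_carrier[of 0] by (auto simp: P_def zigzag)
  qed
  then have P0: "P (2 * a) = 0\<^sub>m (v 0) (v 0)" if "a \<ge> N" for a
    using that by auto
  have P_Suc: "P (2 * Suc a) = x (Up 0) * x (Down 0) * P (2 * a)" for a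
    using Pc[of "2 * a"] Up_carrier[of 0] Down_carrier[of 0]
      assoc_mult_mat[of "x (Up 0)" "v 0" "v (-1)" "x (Down 0)" "v 0" "P (2 * a)" "v 0"]
    by (simp add: P_def zigzag)
  have "covector x j 0 a = j 0 * P (2 * a)" for a
  proof (induction a)
    case 0
    show ?case using covector_carrier[of 0 0] by (simp add: covector_zero P_def zigzag)
  next
    case (Suc a)
    have j0: "j 0 \<in> carrier_mat 1 (v 0)"
      using covector_carrier[of 0 0] by (simp add: covector_zero)
    have "P (2 * a) * (x (Up 0) * x (Down 0)) = x (Up 0) * x (Down 0) * P (2 * a)"
    proof (induction a)
      case 0
      show ?case
        using left_mult_one_mat[OF Up_Down_carrier[of 0]] right_mult_one_mat[OF Up_Down_carrier[of 0]]
        by (simp add: P_def zigzag)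
    next
      case (Suc a)
      let ?T = "x (Up 0) * x (Down 0)"
      have "?T * P (2 * a) * ?T = ?T * (P (2 * a) * ?T)"
        using Pc[of "2 * a"] Up_Down_carrier[of 0] by (intro assoc_mult_mat) auto
      then show ?case using Suc.IH P_Suc by simp
    qed
    then have "P (2 * Suc a) = P (2 * a) * (x (Up 0) * x (Down 0))"
      using P_Suc by simp
    moreover have "j 0 * P (2 * a) * (x (Up 0) * x (Down 0)) = j 0 * (P (2 * a) * (x (Up 0) * x (Down 0)))"
      using Pc[of "2 * a"] Up_Down_carrier[of 0] j0 by (intro assoc_mult_mat) auto
    ultimately show ?case using Suc.IH covector_zero_Suc[of a] by simp
  qed
  then have zero: "covector x j 0 a = 0\<^sub>m 1 (v 0)" if "a \<ge> N" for a
    using P0[OF that] covector_carrier[of 0 0] by (simp add: covector_zero)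
  have "covector x j d a = 0\<^sub>m 1 (v d)" if a: "a \<ge> N" for d a
  proof (cases "0 \<le> d")
    case True
    then show ?thesis
    proof (induction d rule: int_ge_induct)
      case base
      then show ?case using zero a by simp
    next
      case (step d)
      then show ?case
        using covector_Down_right[of "d + 1" x j a] Down_carrier[of "d + 1"] by simp
    qed
  next
    case False
    then have "d \<le> 0" by simp
    then show ?thesis
    proof (induction d rule: int_le_induct)
      case base
      then show ?case using zero a by simp
    next
      case (step d)
      then show ?case
        using covector_Up_left[of d x j a] Up_carrier[of d] by simp
    qed
  qed
  then show ?thesis by blast
qed

context
  assumes st: "stable v w0 (x, j)"
begin

text \<open>
  The common kernel of the covectors is invariant under all arrows because the transposed arrows carry
  covectors to covectors, and it is annihilated by \<open>j\<close>, which is itself a covector. So stability applies.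
\<close>

lemma covector_separates:
  assumes u: "u \<in> carrier_vec (v d)" and z: "\<And>a. covector x j d a *\<^sub>v u = 0\<^sub>v 1"
  shows "u = 0\<^sub>v (v d)"
proof -
  define S where "S d = {u \<in> carrier_vec (v d). \<forall>a. covector x j d a *\<^sub>v u = 0\<^sub>v 1}" for d
  have "VectorSpace.subspace class_ring (S d) (module_vec TYPE(complex) (v d))" for d
  proof (rule subspace_module_vecI)
    show "u + w \<in> S d" if "u \<in> S d" "w \<in> S d" for u w
      using that mult_add_distrib_mat_vec[OF covector_carrier] by (auto simp: S_def)
    show "c \<cdot>\<^sub>v u \<in> S d" if "u \<in> S d" for c u
      using that mult_mat_vec[OF covector_carrier] by (auto simp: S_def)
    have "covector x j d a *\<^sub>v 0\<^sub>v (v d) = 0\<^sub>v 1" for a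
    proof -
      have "row (covector x j d a) 0 \<in> carrier_vec (v d)"
        using covector_carrier[of d a] row_carrier by (metis carrier_matD(2))
      then show ?thesis
        using covector_carrier[of d a] by (intro eq_vecI) auto
    qed
    then show "0\<^sub>v (v d) \<in> S d"
      by (auto simp: S_def)
  qed (auto simp: S_def)
  moreover have "x h *\<^sub>v u \<in> S (tgt h)" if u: "u \<in> S (src h)" for h u
  proof -
    have c: "x h \<in> carrier_mat (v (tgt h)) (v (src h))"
      using x by (simp add: Lam_def E_def)
    have "covector x j (tgt h) a *\<^sub>v (x h *\<^sub>v u) = 0\<^sub>v 1" for a
    proof -
      have uc: "u \<in> carrier_vec (v (src h))" using u by (simp add: S_def)
      have "covector x j (tgt h) a *\<^sub>v (x h *\<^sub>v u) = (covector x j (tgt h) a * x h) *\<^sub>v u"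
        using assoc_mult_mat_vec[OF covector_carrier c uc] by simp
      also have "\<dots> = 0\<^sub>v 1"
      proof (cases "\<exists>b. diagram_step h a b")
        case True
        then show ?thesis using u covector_mult by (auto simp: S_def)
      next
        case False
        then show ?thesis by (cases h) (auto split: if_splits)
      qed
      finally show ?thesis .
    qed
    then show ?thesis using c u by (auto simp: S_def intro!: mult_mat_vec_carrier)
  qed
  moreover have "j i *\<^sub>v u = 0\<^sub>v (w0 i)" if u: "u \<in> S i" for i u
  proof (cases "i = 0")
    case True
    then show ?thesis
      using u by (auto simp: S_def w0_def covector_zero dest: spec[of _ 0])
  next
    case False
    have "j i \<in> carrier_mat (w0 i) (v i)"
      using j unfolding homVW_def by blast
    then show ?thesis
      using False by (intro eq_vecI) (auto simp: w0_def)
  qed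
  ultimately have "S d = {0\<^sub>v (v d)}"
    using st unfolding stable_def fst_conv snd_conv by blast
  moreover have "u \<in> S d" using u z by (simp add: S_def)
  ultimately show ?thesis by blast
qed

lemma covector_shift_combination:
  assumes "\<And>b. b < v d \<Longrightarrow> (\<Sum>a<m. c a * covector x j d a $$ (0, b)) = 0"
    and "b < v d"
  shows "(\<Sum>a<m. c a * covector x j d (a + k) $$ (0, b)) = 0"
  using assms(2)
proof (induction k arbitrary: b)
  case 0
  then show ?case using assms(1) by simp
next
  case (Suc k)
  let ?T = "x (Up d) * x (Down d)"
  have "covector x j d (Suc a) $$ (0, b) = (\<Sum>l<v d. covector x j d a $$ (0, l) * ?T $$ (l, b))" for a
  proof -
    have "covector x j d (Suc a) $$ (0, b) = (covector x j d a * ?T) $$ (0, b)"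
      by (simp only: covector_Suc)
    also have "\<dots> = row (covector x j d a) 0 \<bullet> col ?T b"
      using Suc.prems covector_carrier[of d a] Up_Down_carrier[of d] by (intro index_mult_mat(1)) auto
    also have "\<dots> = (\<Sum>l<v d. covector x j d a $$ (0, l) * ?T $$ (l, b))"
      unfolding scalar_prod_def
      using Suc.prems covector_carrier[of d a] Up_Down_carrier[of d]
      by (intro sum.cong) (auto simp del: index_mult_mat)
    finally show ?thesis .
  qed
  then have "(\<Sum>a<m. c a * covector x j d (a + Suc k) $$ (0, b)) =
    (\<Sum>a<m. \<Sum>l<v d. c a * covector x j d (a + k) $$ (0, l) * ?T $$ (l, b))"
    by (simp add: sum_distrib_left mult.assoc)
  also have "\<dots> = (\<Sum>l<v d. (\<Sum>a<m. c a * covector x j d (a + k) $$ (0, l)) * ?T $$ (l, b))"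
    by (subst sum.swap) (simp add: sum_distrib_right)
  also have "\<dots> = 0"
    using Suc.IH by simp
  finally show ?case .
qed

text \<open>
  Let \<open>m\<close> be the index of the first covector that vanishes in degree \<open>d\<close>. The \<open>m\<close> covectors before it have
  no common kernel by stability, so \<open>v d \<le> m\<close>. They are linearly independent because \<open>XY\<close> shifts them as a
  nilpotent Jordan block, so \<open>m \<le> v d\<close>.
\<close>

lemma covector_eq_0_iff: "covector x j d a = 0\<^sub>m 1 (v d) \<longleftrightarrow> v d \<le> a"
proof -
  define m where "m = (LEAST m. covector x j d m = 0\<^sub>m 1 (v d))"
  obtain N where "\<forall>d. \<forall>a\<ge>N. covector x j d a = 0\<^sub>m 1 (v d)"
    using covector_eventually_zero by blast
  then have "covector x j d N = 0\<^sub>m 1 (v d)" by blast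
  then have m: "covector x j d m = 0\<^sub>m 1 (v d)"
    unfolding m_def by (rule LeastI)
  have below: "covector x j d a \<noteq> 0\<^sub>m 1 (v d)" if "a < m" for a
    using not_less_Least that unfolding m_def by blast
  have above: "m \<le> a \<Longrightarrow> covector x j d a = 0\<^sub>m 1 (v d)" for a
  proof (induction a rule: dec_induct)
    case (step a)
    show ?case
      unfolding covector_Suc[symmetric] step.IH by (rule left_mult_zero_mat[OF Up_Down_carrier])
  qed (rule m)
  define G where "G = mat m (v d) (\<lambda>(a, b). covector x j d a $$ (0, b))"
  have G: "G \<in> carrier_mat m (v d)" by (simp add: G_def)
  have row_G: "row G a = row (covector x j d a) 0" if "a < m" for a
    using that covector_carrier[of d a] by (intro eq_vecI) (auto simp: G_def)
  have "v d \<le> m"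
  proof (rule ccontr)
    assume "\<not> v d \<le> m"
    then have "m < v d" by simp
    then obtain u where u: "u \<in> carrier_vec (v d)" "u \<noteq> 0\<^sub>v (v d)" "G *\<^sub>v u = 0\<^sub>v m"
      by (rule wide_matrix_kernel[OF G])
    have "u = 0\<^sub>v (v d)"
    proof (rule covector_separates[OF u(1)])
      fix a
      show "covector x j d a *\<^sub>v u = 0\<^sub>v 1"
      proof (cases "a < m")
        case True
        have "row (covector x j d a) 0 \<bullet> u = (G *\<^sub>v u) $ a"
          using True row_G G by simp
        then show ?thesis
          using True u covector_carrier[of d a] by (intro eq_vecI) auto
      next
        case False
        then have "covector x j d a = 0\<^sub>m 1 (v d)" using above by simp
        then show ?thesis using u(1) by (simp only: zero_mat_mult_vec)
      qed
    qed
    then show False using u(2) by simp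
  qed
  moreover have "m \<le> v d"
  proof (rule ccontr)
    assume "\<not> m \<le> v d"
    then have "v d < m" by simp
    moreover have "G\<^sup>T \<in> carrier_mat (v d) m" using G by simp
    ultimately obtain c where c: "c \<in> carrier_vec m" "c \<noteq> 0\<^sub>v m" "G\<^sup>T *\<^sub>v c = 0\<^sub>v (v d)"
      using wide_matrix_kernel by blast
    have rel: "(\<Sum>a<m. c $ a * covector x j d a $$ (0, b)) = 0" if b: "b < v d" for b
    proof -
      have "(\<Sum>a<m. c $ a * covector x j d a $$ (0, b)) = (G\<^sup>T *\<^sub>v c) $ b"
        using b c(1) by (auto simp: G_def scalar_prod_def mult.commute intro!: sum.cong)
      then show ?thesis using c b by simp
    qed
    have "c $ a = 0" if "a < m" for a
      using that
    proof (induction a rule: less_induct)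
      case (less a)
      \<comment> \<open>Shifting the relation until \<open>covector x j d (m - 1)\<close> is the last surviving term isolates \<open>c $ a\<close>.\<close>
      have "c $ a * covector x j d (m - 1) $$ (0, b) = 0" if b: "b < v d" for b
      proof -
        have "(\<Sum>i<m. c $ i * covector x j d (i + (m - 1 - a)) $$ (0, b)) =
          (\<Sum>i<m. if i = a then c $ a * covector x j d (m - 1) $$ (0, b) else 0)"
        proof (rule sum.cong)
          fix i assume "i \<in> {..<m}"
          then consider "i < a" | "i = a" | "i > a" by linarith
          then show "c $ i * covector x j d (i + (m - 1 - a)) $$ (0, b) =
            (if i = a then c $ a * covector x j d (m - 1) $$ (0, b) else 0)"
          proof cases
            case 1
            then show ?thesis using less by simp
          next
            case 2
            then show ?thesis using less by simp
          next
            case 3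
            then have "m \<le> i + (m - 1 - a)" using less by simp
            then show ?thesis using 3 above b by simp
          qed
        qed simp
        also have "\<dots> = c $ a * covector x j d (m - 1) $$ (0, b)"
          using less.prems by simp
        finally show ?thesis
          using covector_shift_combination[of d "\<lambda>a. c $ a" m, OF rel b, where k="m - 1 - a"]
          by (simp only:)
      qed
      moreover have "\<exists>b<v d. covector x j d (m - 1) $$ (0, b) \<noteq> 0"
      proof (rule ccontr)
        assume "\<not> ?thesis"
        then have "covector x j d (m - 1) = 0\<^sub>m 1 (v d)"
          using covector_carrier[of d "m - 1"] by (intro eq_matI) auto
        then show False using below[of "m - 1"] less.prems by simp
      qed
      ultimately show ?case by auto
    qed
    then have "c = 0\<^sub>v m" using c(1) by (intro eq_vecI) auto
    then show False using c(2) by simp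
  qed
  ultimately show ?thesis using above below by (metis le_antisym not_le)
qed

text \<open>
  An arrow takes vanishing covectors to vanishing covectors, and \<open>v\<close> records where they start to vanish.
\<close>

lemma staircase_dimension: "staircase v"
  unfolding staircase_def
proof (intro conjI allI impI)
  fix d :: int
  have vanish: "covector x j (d - 1) a = 0\<^sub>m 1 (v (d - 1)) \<Longrightarrow> diagram_step (Down d) a b \<Longrightarrow> v d \<le> b"
    "covector x j d a = 0\<^sub>m 1 (v d) \<Longrightarrow> diagram_step (Up d) a b \<Longrightarrow> v (d - 1) \<le> b" for a b
    using covector_mult[of "Down d" a b] covector_mult[of "Up d" a b]
      Down_carrier[of d] Up_carrier[of d] covector_eq_0_iff[of d b] covector_eq_0_iff[of "d - 1" b]
    by (simp_all del: diagram_step.simps)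
  show "v d \<le> v (d - 1)" if "1 \<le> d"
    using vanish(1)[of "v (d - 1)" "v (d - 1)"] covector_eq_0_iff that by simp
  show "v (d - 1) \<le> Suc (v d)" if "1 \<le> d"
    using vanish(2)[of "v d" "Suc (v d)"] covector_eq_0_iff that by simp
  show "v (d - 1) \<le> v d" if "d \<le> 0"
    using vanish(2)[of "v d" "v d"] covector_eq_0_iff that by simp
  show "v d \<le> Suc (v (d - 1))" if "d \<le> 0"
    using vanish(1)[of "v (d - 1)" "Suc (v (d - 1))"] covector_eq_0_iff that by simp
qed

text \<open>
  In the coordinates of \<open>V\<^sub>d\<close> given by the nonvanishing covectors the representation takes its normal form.
\<close>

definition covector_frame :: gmat where
  "covector_frame d = mat (v d) (v d) (\<lambda>(a, b). covector x j d a $$ (0, b))"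

lemma covector_frame_GV: "covector_frame \<in> GV v"
proof -
  have "\<exists>B. B \<in> carrier_mat (v d) (v d) \<and> covector_frame d * B = 1\<^sub>m (v d) \<and> B * covector_frame d = 1\<^sub>m (v d)" for d
  proof (rule invertible_if_injective[of "covector_frame d" "v d"])
    show G: "covector_frame d \<in> carrier_mat (v d) (v d)" by (simp add: covector_frame_def)
    fix u assume u: "u \<in> carrier_vec (v d)" "covector_frame d *\<^sub>v u = 0\<^sub>v (v d)"
    show "u = 0\<^sub>v (v d)"
    proof (rule covector_separates[OF u(1)])
      fix a
      show "covector x j d a *\<^sub>v u = 0\<^sub>v 1"
      proof (cases "a < v d")
        case True
        have "row (covector_frame d) a = row (covector x j d a) 0"
          using True covector_carrier[of d a] by (intro eq_vecI) (auto simp: covector_frame_def)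
        then have "row (covector x j d a) 0 \<bullet> u = (covector_frame d *\<^sub>v u) $ a"
          using True G by simp
        then show ?thesis
          using True u covector_carrier[of d a] by (intro eq_vecI) auto
      next
        case False
        then have "covector x j d a = 0\<^sub>m 1 (v d)" using covector_eq_0_iff by simp
        then show ?thesis using u(1) by (simp only: zero_mat_mult_vec)
      qed
    qed
  qed blast
  then obtain B where "\<And>d. B d \<in> carrier_mat (v d) (v d) \<and> covector_frame d * B d = 1\<^sub>m (v d) \<and> B d * covector_frame d = 1\<^sub>m (v d)"
    by metis
  then show ?thesis
    by (intro GV_I[of _ _ B]) (auto simp: covector_frame_def)
qed

lemma covector_frame_act:
  "framed_act covector_frame (x, j) = (diagram_rep v, diagram_framing v)"
proof -
  let ?g = covector_frame
  have gc: "?g d \<in> carrier_mat (v d) (v d)" for d by (simp add: covector_frame_def)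
  note inv = GV_inverse[OF covector_frame_GV]
  have xc: "x h \<in> carrier_mat (v (tgt h)) (v (src h))" for h
    using x by (simp add: Lam_def E_def)
  have "?g (tgt h) * x h = diagram_rep v h * ?g (src h)" for h
  proof (rule eq_matI)
    fix a b assume "a < dim_row (diagram_rep v h * ?g (src h))" "b < dim_col (diagram_rep v h * ?g (src h))"
    then have ab: "a < v (tgt h)" "b < v (src h)" using gc[of "src h"] by auto
    have row: "row (?g (tgt h)) a = row (covector x j (tgt h) a) 0"
      using ab covector_carrier[of "tgt h" a] by (intro eq_vecI) (auto simp: covector_frame_def)
    have "(?g (tgt h) * x h) $$ (a, b) = (covector x j (tgt h) a * x h) $$ (0, b)"
      using ab gc[of "tgt h"] xc[of h] covector_carrier[of "tgt h" a] row by simp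
    also have "\<dots> = (diagram_rep v h * ?g (src h)) $$ (a, b)"
    proof (cases "\<exists>k. diagram_step h a k")
      case True
      then obtain k where k: "diagram_step h a k" by blast
      have "(diagram_rep v h * ?g (src h)) $$ (a, b) = (if k < v (src h) then ?g (src h) $$ (k, b) else 0)"
        by (rule diagram_rep_mult_entry[OF gc ab k])
      moreover have "covector x j (src h) k $$ (0, b) = 0" if "\<not> k < v (src h)"
        using covector_eq_0_iff[of "src h" k] that ab by simp
      ultimately show ?thesis
        using covector_mult[OF k] ab by (simp add: covector_frame_def)
    next
      case False
      then show ?thesis by (cases h) (auto split: if_splits)
    qed
    finally show "(?g (tgt h) * x h) $$ (a, b) = (diagram_rep v h * ?g (src h)) $$ (a, b)" .
  qed (use gc[of "src h"] gc[of "tgt h"] xc[of h] in auto)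
  then have "rep_act ?g x h = diagram_rep v h" for h
  proof -
    assume *: "\<And>h. ?g (tgt h) * x h = diagram_rep v h * ?g (src h)"
    have "diagram_rep v h * ?g (src h) * inv_at ?g (src h) = diagram_rep v h * (?g (src h) * inv_at ?g (src h))"
      using gc inv(1) by (intro assoc_mult_mat[of _ "v (tgt h)" "v (src h)"]) auto
    then show ?thesis
      using inv(2)[of "src h"] right_mult_one_mat[of "diagram_rep v h" "v (tgt h)" "v (src h)"]
      by (simp add: rep_act_def *)
  qed
  moreover have "j i * inv_at ?g i = diagram_framing v i" for i
  proof (cases "i = 0")
    case True
    have jc: "j 0 \<in> carrier_mat 1 (v 0)"
      using covector_carrier[of 0 0] by (simp add: covector_zero)
    have dc: "diagram_framing v 0 \<in> carrier_mat 1 (v 0)"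
      by (simp add: diagram_framing_def w0_def)
    have "j 0 = diagram_framing v 0 * ?g 0"
    proof (rule eq_matI)
      fix a b assume "a < dim_row (diagram_framing v 0 * ?g 0)" "b < dim_col (diagram_framing v 0 * ?g 0)"
      then have ab: "a = 0" "b < v 0" using dc gc[of 0] by auto
      have "(diagram_framing v 0 * ?g 0) $$ (a, b) = (\<Sum>k\<in>{0..<v 0}. (if k = 0 then 1 else 0) * ?g 0 $$ (k, b))"
        using ab gc[of 0] by (simp add: scalar_prod_def diagram_framing_def w0_def)
      also have "\<dots> = (\<Sum>k\<in>{0..<v 0}. if k = 0 then ?g 0 $$ (k, b) else 0)"
        by (intro sum.cong) auto
      also have "\<dots> = j 0 $$ (a, b)"
        using ab by (simp add: covector_frame_def covector_zero)
      finally show "j 0 $$ (a, b) = (diagram_framing v 0 * ?g 0) $$ (a, b)" by simp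
    qed (use jc dc gc[of 0] in auto)
    then have "j 0 * inv_at ?g 0 = diagram_framing v 0 * (?g 0 * inv_at ?g 0)"
      using assoc_mult_mat[OF dc gc inv(1)] by simp
    then show ?thesis
      using True inv(2)[of 0] dc by simp
  next
    case False
    have "j i \<in> carrier_mat (w0 i) (v i)"
      using j unfolding homVW_def by blast
    then have jc: "j i \<in> carrier_mat 0 (v i)"
      using False by (simp add: w0_def)
    show ?thesis
    proof (rule eq_matI)
      show "dim_row (j i * inv_at ?g i) = dim_row (diagram_framing v i)"
        using jc False by (simp add: diagram_framing_def w0_def)
      show "dim_col (j i * inv_at ?g i) = dim_col (diagram_framing v i)"
        using inv(1)[of i] by (simp add: diagram_framing_def)
    qed (use False in \<open>simp add: diagram_framing_def w0_def\<close>)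
  qed
  ultimately show ?thesis
    by (simp add: framed_act_def fun_eq_iff)
qed

end

end

section \<open>Young diagrams and their contents\<close>

definition in_diagram :: "nat list \<Rightarrow> nat \<Rightarrow> nat \<Rightarrow> bool" where
  "in_diagram Y r c \<longleftrightarrow> r < length Y \<and> c < Y ! r"

lemma in_diagram_antimono:
  assumes "Y \<in> young_diagrams" "in_diagram Y r c" "r' \<le> r" "c' \<le> c"
  shows "in_diagram Y r' c'"
proof -
  have "Y ! r \<le> Y ! r'"
    using assms unfolding young_diagrams_def in_diagram_def
    by (cases "r' = r") (auto simp: sorted_wrt_iff_nth_less)
  then show ?thesis
    using assms by (auto simp: in_diagram_def)
qed

lemma finite_in_diagram: "finite {(r, c). in_diagram Y r c}"
proof (rule finite_subset)
  show "{(r, c). in_diagram Y r c} \<subseteq> {..<length Y} \<times> {..<Suc (sum_list Y)}"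
    using elem_le_sum_list[of _ Y] by (fastforce simp: in_diagram_def)
qed (auto intro: finite_cartesian_product)

lemma downclosed_nat_set_eq:
  fixes S :: "nat set"
  assumes "finite S" and down: "\<And>a b. b \<in> S \<Longrightarrow> a \<le> b \<Longrightarrow> a \<in> S"
  shows "a \<in> S \<longleftrightarrow> a < card S"
proof -
  have "S = {..<card S}"
  proof (cases "S = {}")
    case False
    have "a \<in> S" if "a \<le> Max S" for a
      using down[OF Max_in[OF assms(1) False] that] .
    then have "S = {..Max S}"
      using assms(1) by auto
    then have "card S = Suc (Max S)" by (metis card_atMost)
    then show ?thesis using \<open>S = {..Max S}\<close> by (simp add: lessThan_Suc_atMost)
  qed simp
  then show ?thesis by blast
qed

definition row_interval :: "nat list \<Rightarrow> nat \<Rightarrow> int \<times> int" where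
  "row_interval Y r = (- int r, int (Y ! r) - 1 - int r)"

lemma A_of_eq: "A_of Y = row_interval Y ` {..<length Y}"
proof -
  have "{i. 1 \<le> i \<and> i \<le> length Y} = Suc ` {..<length Y}"
    using image_Suc_lessThan by auto
  then have "A_of Y = (\<lambda>i. (1 - int i, int (Y ! (i - 1)) - int i)) ` Suc ` {..<length Y}"
    unfolding A_of_def by blast
  then show ?thesis
    by (simp add: image_image row_interval_def algebra_simps)
qed

lemma inj_row_interval: "inj_on (row_interval Y) A"
  by (auto simp: row_interval_def inj_on_def)

lemma f_of_Ztilde:
  assumes "Y \<in> young_diagrams"
  shows "f_of Y \<in> Ztilde_of (graded_dim (f_of Y))"
proof -
  have "row_interval Y r \<in> Zinf" if "r < length Y" for r
    using assms that nth_mem[OF that] by (auto simp: Zinf_def row_interval_def young_diagrams_def)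
  then show ?thesis
    by (auto simp: Ztilde_of_def Ztilde_def f_of_def A_of_eq)
qed

lemma graded_dim_card_rows:
  "graded_dim (f_of Y) d = card {r. r < length Y \<and> - int r \<le> d \<and> d < int (Y ! r) - int r}"
proof -
  have "{p. f_of Y p \<noteq> 0 \<and> fst p \<le> d \<and> d \<le> snd p} =
      row_interval Y ` {r. r < length Y \<and> - int r \<le> d \<and> d < int (Y ! r) - int r}" (is "_ = _ ` ?R")
    by (auto simp: f_of_def A_of_eq row_interval_def)
  then have "graded_dim (f_of Y) d = (\<Sum>p\<in>row_interval Y ` ?R. f_of Y p)"
    by (simp add: graded_dim_def)
  also have "\<dots> = (\<Sum>p\<in>row_interval Y ` ?R. 1)"
    by (intro sum.cong) (auto simp: f_of_def A_of_eq)
  also have "\<dots> = card ?R"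
    using card_image[OF inj_row_interval] by simp
  finally show ?thesis .
qed

text \<open>
  The boxes of content \<open>d\<close> form an initial segment of their diagonal, and each row that meets the diagonal
  contributes one interval containing \<open>d\<close>. So the number of boxes determines which boxes are present.
\<close>

lemma less_graded_dim_iff:
  assumes Y: "Y \<in> young_diagrams"
  shows "a < graded_dim (f_of Y) d \<longleftrightarrow> in_diagram Y (a + nat (- d)) (a + nat d)"
proof -
  define S where "S = {a. in_diagram Y (a + nat (- d)) (a + nat d)}"
  have fin: "finite S"
  proof (rule finite_subset)
    show "S \<subseteq> {..<length Y}" by (auto simp: S_def in_diagram_def)
  qed simp
  have "{r. r < length Y \<and> - int r \<le> d \<and> d < int (Y ! r) - int r} = (\<lambda>a. a + nat (- d)) ` S"
  proof (intro subset_antisym subsetI)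
    fix r assume "r \<in> {r. r < length Y \<and> - int r \<le> d \<and> d < int (Y ! r) - int r}"
    then have "r = (r - nat (- d)) + nat (- d)" "r - nat (- d) \<in> S"
      by (auto simp: S_def in_diagram_def)
    then show "r \<in> (\<lambda>a. a + nat (- d)) ` S" by blast
  qed (auto simp: S_def in_diagram_def)
  then have "graded_dim (f_of Y) d = card S"
    unfolding graded_dim_card_rows by (simp add: card_image)
  then show ?thesis
    using downclosed_nat_set_eq[OF fin, of a] in_diagram_antimono[OF Y]
    by (auto simp: S_def)
qed

lemma in_diagram_iff_less_graded_dim:
  assumes Y: "Y \<in> young_diagrams"
  shows "in_diagram Y r c \<longleftrightarrow> min r c < graded_dim (f_of Y) (int c - int r)"
  unfolding less_graded_dim_iff[OF Y] by (cases "r \<le> c") (auto simp: min_def nat_diff_distrib)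

lemma graded_dim_graded_dims:
  assumes Y: "Y \<in> young_diagrams"
  shows "graded_dim (f_of Y) \<in> graded_dims"
proof -
  have "{d. graded_dim (f_of Y) d \<noteq> 0} \<subseteq> (\<lambda>(r, c). int c - int r) ` {(r, c). in_diagram Y r c}"
  proof
    fix d assume "d \<in> {d. graded_dim (f_of Y) d \<noteq> 0}"
    then have "in_diagram Y (nat (- d)) (nat d)"
      using less_graded_dim_iff[OF Y, of 0 d] by simp
    then show "d \<in> (\<lambda>(r, c). int c - int r) ` {(r, c). in_diagram Y r c}"
      by (intro image_eqI[of _ _ "(nat (- d), nat d)"]) auto
  qed
  then show ?thesis
    using finite_in_diagram finite_subset unfolding graded_dims_def by blast
qed

lemma graded_dim_staircase:
  assumes Y: "Y \<in> young_diagrams"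
  shows "staircase (graded_dim (f_of Y))"
proof -
  let ?v = "graded_dim (f_of Y)"
  have le: "?v d \<le> ?v d'" if "\<And>a. a < ?v d \<Longrightarrow> a < ?v d'" for d d'
    using that by (metis not_le order_less_irrefl)
  have le': "?v d \<le> Suc (?v d')" if "\<And>a. Suc a < ?v d \<Longrightarrow> a < ?v d'" for d d'
    using that[of "?v d'"] by (meson less_irrefl not_less)
  note mono = in_diagram_antimono[OF Y]
  note iff = less_graded_dim_iff[OF Y]
  show ?thesis
    unfolding staircase_def
  proof (intro conjI allI impI)
    fix d :: int
    show "?v d \<le> ?v (d - 1)" if "1 \<le> d"
      by (rule le) (unfold iff, erule mono, use that in auto)
    show "?v (d - 1) \<le> Suc (?v d)" if "1 \<le> d"
      by (rule le') (unfold iff, erule mono, use that in auto)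
    show "?v (d - 1) \<le> ?v d" if "d \<le> 0"
      by (rule le) (unfold iff, erule mono, use that in auto)
    show "?v d \<le> Suc (?v (d - 1))" if "d \<le> 0"
      by (rule le') (unfold iff, erule mono, use that in auto)
  qed
qed

lemma young_diagram_eqI:
  assumes Y: "Y \<in> young_diagrams" and Z: "Z \<in> young_diagrams"
    and eq: "\<And>r c. in_diagram Y r c \<longleftrightarrow> in_diagram Z r c"
  shows "Y = Z"
proof (rule nth_equalityI)
  have len: "{r. in_diagram X r 0} = {..<length X}" if "X \<in> young_diagrams" for X
    using that by (auto simp: in_diagram_def young_diagrams_def)
  then have "{..<length Y} = {..<length Z}"
    using len[OF Y] len[OF Z] by (simp add: eq)
  then show *: "length Y = length Z" by simp
  show "Y ! r = Z ! r" if "r < length Y" for r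
  proof -
    have row: "{c. in_diagram X r c} = {..<X ! r}" if "r < length X" for X
      using that by (auto simp: in_diagram_def)
    have "{..<Y ! r} = {..<Z ! r}"
      using row[of Y] row[of Z] that by (simp add: eq *)
    then show ?thesis by simp
  qed
qed

lemma graded_dim_inj:
  assumes "Y \<in> young_diagrams" "Z \<in> young_diagrams" "graded_dim (f_of Y) = graded_dim (f_of Z)"
  shows "Y = Z"
  using assms in_diagram_iff_less_graded_dim by (intro young_diagram_eqI) auto

text \<open>
  The boxes that \<open>v\<close> prescribes on each diagonal form a finite set which, by the staircase inequalities, is
  closed under moving left and moving up. The row lengths of such a set form a Young diagram.
\<close>

lemma staircase_young_diagram:
  assumes v: "v \<in> graded_dims" "staircase v"
  obtains Y where "Y \<in> young_diagrams" "graded_dim (f_of Y) = v"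
proof -
  define D where "D r c \<longleftrightarrow> min r c < v (int c - int r)" for r c :: nat
  have stepc: "D r c" if "D r (Suc c)" for r c
    using that staircaseD[OF v(2), of "int c - int r + 1"]
    by (cases "r \<le> c") (auto simp: D_def algebra_simps min_def split: if_splits)
  have stepr: "D r c" if "D (Suc r) c" for r c
    using that staircaseD[OF v(2), of "int c - int r"]
    by (cases "r < c") (auto simp: D_def algebra_simps min_def split: if_splits)
  have monoc: "D r c" if "D r c'" "c \<le> c'" for r c c'
    using that(2,1) by (induction c' rule: dec_induct) (auto intro: stepc)
  have monor: "D r c" if "D r' c" "r \<le> r'" for r r' c
    using that(2,1) by (induction r' rule: dec_induct) (auto intro: stepr)
  have fin: "finite {i. v i \<noteq> 0}" using v(1) by (simp add: graded_dims_def)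
  have fin_row: "finite {c. D r c}" for r
  proof (rule finite_subset)
    show "{c. D r c} \<subseteq> (\<lambda>d. nat (d + int r)) ` {i. v i \<noteq> 0}"
    proof
      fix c assume "c \<in> {c. D r c}"
      then show "c \<in> (\<lambda>d. nat (d + int r)) ` {i. v i \<noteq> 0}"
        by (intro image_eqI[of _ _ "int c - int r"]) (auto simp: D_def)
    qed
  qed (use fin in simp)
  have fin_col: "finite {r. D r c}" for c
  proof (rule finite_subset)
    show "{r. D r c} \<subseteq> (\<lambda>d. nat (int c - d)) ` {i. v i \<noteq> 0}"
    proof
      fix r assume "r \<in> {r. D r c}"
      then show "r \<in> (\<lambda>d. nat (int c - d)) ` {i. v i \<noteq> 0}"
        by (intro image_eqI[of _ _ "int c - int r"]) (auto simp: D_def)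
    qed
  qed (use fin in simp)
  define Y where "Y = map (\<lambda>r. card {c. D r c}) [0..<card {r. D r 0}]"
  have len: "r < length Y \<longleftrightarrow> D r 0" for r
    using downclosed_nat_set_eq[OF fin_col[of 0], of r] monor by (auto simp: Y_def)
  have row: "c < Y ! r \<longleftrightarrow> D r c" if "r < length Y" for r c
    using downclosed_nat_set_eq[OF fin_row[of r], of c] monoc that by (auto simp: Y_def)
  have in_Y: "in_diagram Y r c \<longleftrightarrow> D r c" for r c
    unfolding in_diagram_def using len row monoc[of r c 0] by blast
  have Y: "Y \<in> young_diagrams"
    unfolding young_diagrams_def sorted_wrt_iff_nth_less mem_Collect_eq
  proof (intro conjI allI impI ballI)
    fix r r' assume r: "r < r'" "r' < length Y"
    show "Y ! r' \<le> Y ! r"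
    proof (rule ccontr)
      assume "\<not> ?thesis"
      then have "D r' (Y ! r)" using row[of r' "Y ! r"] r by simp
      then have "D r (Y ! r)" using monor[of r' "Y ! r" r] r by simp
      then show False using row[of r "Y ! r"] r by simp
    qed
  next
    fix l assume "l \<in> set Y"
    then obtain r where "r < length Y" "l = Y ! r" by (auto simp: in_set_conv_nth)
    then show "0 < l" using row[of r 0] len[of r] by simp
  qed
  have "a < graded_dim (f_of Y) d \<longleftrightarrow> a < v d" for a d
    unfolding less_graded_dim_iff[OF Y] in_Y D_def by (cases "0 \<le> d") (auto simp: min_def)
  then have "graded_dim (f_of Y) d = v d" for d
    by (metis linorder_neqE_nat less_irrefl)
  with Y show ?thesis by (intro that) auto
qed

section \<open>Sums of intervals\<close>

definition intervals_dim :: "(int \<times> int) list \<Rightarrow> int \<Rightarrow> nat" where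
  "intervals_dim ps d = (\<Sum>p\<leftarrow>ps. interval_dim p d)"

lemma intervals_dim_simps [simp]:
  "intervals_dim [] d = 0" "intervals_dim (p # ps) d = interval_dim p d + intervals_dim ps d"
  by (simp_all add: intervals_dim_def)

lemma intervals_dim_eq_graded_dim:
  assumes "\<forall>p. count_list ps p = f p"
  shows "intervals_dim ps = graded_dim f"
proof
  fix d
  have f: "f = count_list ps"
    using assms by auto
  have set: "set ps = {p. f p \<noteq> 0}"
    unfolding f by (metis (mono_tags, lifting) Collect_cong Collect_mem_eq count_list_0_iff)
  then have fin: "finite {p. f p \<noteq> 0}" by (metis finite_set)
  have "intervals_dim ps d = (\<Sum>p\<in>set ps. f p * interval_dim p d)"
    by (simp add: f intervals_dim_def sum_list_map_eq_sum_count)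
  also have "\<dots> = (\<Sum>p | f p \<noteq> 0 \<and> fst p \<le> d \<and> d \<le> snd p. f p * interval_dim p d)"
    using fin unfolding set by (intro sum.mono_neutral_right) (auto simp: interval_dim_def)
  also have "\<dots> = graded_dim f d"
    unfolding graded_dim_def by (intro sum.cong) (auto simp: interval_dim_def)
  finally show "intervals_dim ps d = graded_dim f d" .
qed

lemma interval_rep_dim [simp]:
  "dim_row (interval_rep p h) = interval_dim p (tgt h)" "dim_col (interval_rep p h) = interval_dim p (src h)"
  by (simp_all add: interval_rep_def)

lemma direct_sum_dim [simp]:
  "dim_row (direct_sum ps h) = intervals_dim ps (tgt h)" "dim_col (direct_sum ps h) = intervals_dim ps (src h)"
  by (simp_all add: direct_sum_def dim_diag_block_mat intervals_dim_def o_def)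

lemma direct_sum_carrier: "direct_sum ps \<in> E (intervals_dim ps)"
  unfolding E_def by (intro CollectI allI carrier_matI direct_sum_dim)

lemma direct_sum_Cons:
  "direct_sum (p # ps) h = four_block_mat (interval_rep p h)
     (0\<^sub>m (interval_dim p (tgt h)) (intervals_dim ps (src h)))
     (0\<^sub>m (intervals_dim ps (tgt h)) (interval_dim p (src h))) (direct_sum ps h)"
  using direct_sum_dim[of ps h] by (simp add: direct_sum_def Let_def)

lemma direct_sum_Nil: "direct_sum [] h = 0\<^sub>m 0 0"
  by (simp add: direct_sum_def)

lemma direct_sum_Up: "direct_sum ps (Up d) = 0\<^sub>m (intervals_dim ps d) (intervals_dim ps (d - 1))"
proof (induction ps)
  case (Cons p ps)
  have "interval_rep p (Up d) = 0\<^sub>m (interval_dim p d) (interval_dim p (d - 1))"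
    by (auto simp: interval_rep_def Omega_def intro!: eq_matI)
  then show ?case
    unfolding direct_sum_Cons Cons.IH by (intro eq_matI) auto
qed (simp add: direct_sum_Nil)

text \<open>
  The intervals of the rows of a diagram whose first row is row \<open>k\<close>. The offset \<open>k\<close> makes the tail of a diagram an
  instance of the same function, as needed for induction on the rows.
\<close>

fun row_intervals :: "nat \<Rightarrow> nat list \<Rightarrow> (int \<times> int) list" where
  "row_intervals k [] = []"
| "row_intervals k (l # Y) = (- int k, int l - 1 - int k) # row_intervals (Suc k) Y"

lemma row_intervals_eq:
  "row_intervals k Y = map (\<lambda>r. (- int (k + r), int (Y ! r) - 1 - int (k + r))) [0..<length Y]"
proof (induction Y arbitrary: k)
  case (Cons l Y)
  have "[0..<length (l # Y)] = 0 # map Suc [0..<length Y]"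
    by (simp add: upt_conv_Cons map_Suc_upt del: upt_Suc)
  then show ?case by (simp add: Cons.IH o_def)
qed simp

lemma count_list_distinct: "distinct xs \<Longrightarrow> count_list xs x = (if x \<in> set xs then 1 else 0)"
  by (induction xs) auto

lemma count_list_row_intervals: "count_list (row_intervals 0 Y) p = f_of Y p"
proof -
  \<comment> \<open>The summands are pairwise distinct because the rows start in distinct degrees.\<close>
  have rows: "row_intervals 0 Y = map (row_interval Y) [0..<length Y]"
    by (simp add: row_intervals_eq row_interval_def)
  then have "distinct (row_intervals 0 Y)"
    by (simp add: distinct_map inj_row_interval)
  moreover have "set (row_intervals 0 Y) = A_of Y"
    by (simp add: rows A_of_eq lessThan_atLeast0)
  ultimately show ?thesis
    by (simp add: count_list_distinct f_of_def)
qed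

lemma intervals_dim_beyond_rows:
  "\<forall>l'\<in>set Y. l' \<le> l \<Longrightarrow> int l \<le> d + int k \<Longrightarrow> intervals_dim (row_intervals k Y) d = 0"
  by (induction Y arbitrary: k) (auto simp: interval_dim_def)

text \<open>
  For the diagram starting in row \<open>k\<close> the diagonals of content at least \<open>- k\<close> begin in row \<open>k\<close>, the others
  in column \<open>0\<close>. A further row on top adds a first basis vector in the degrees of its interval. Of the
  source and target of \<open>Down (- k)\<close> only the source gains one, so the matrix changes from an identity to a
  shift. At the other end of the interval only a target gains one, but there the matrix has no columns.
\<close>

lemma direct_sum_row_intervals:
  assumes "Y \<in> young_diagrams"
  shows "direct_sum (row_intervals k Y) (Down d) =
    mat (intervals_dim (row_intervals k Y) (d - 1)) (intervals_dim (row_intervals k Y) d)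
      (\<lambda>(a, b). if (if 1 - int k \<le> d then a = b else Suc a = b) then 1 else 0)"
  using assms
proof (induction Y arbitrary: k)
  case (Cons l Y)
  let ?p = "(- int k, int l - 1 - int k)"
  let ?n = "intervals_dim (row_intervals (Suc k) Y)"
  have l: "0 < l" "\<forall>l'\<in>set Y. l' \<le> l" and Y: "Y \<in> young_diagrams"
    using Cons.prems by (auto simp: young_diagrams_def)
  note IH = Cons.IH[OF Y, of "Suc k"]
  have rep: "interval_rep ?p (Down d) = mat (interval_dim ?p (d - 1)) (interval_dim ?p d) (\<lambda>_. 1)"
    by (simp add: interval_rep_def Omega_def)
  consider "d < - int k" | "d = - int k" | "- int k < d" "d < int l - int k" | "int l - int k \<le> d"
    by linarith
  then show ?case
  proof cases
    case 1
    then have "interval_dim ?p d = 0" "interval_dim ?p (d - 1) = 0"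
      by (auto simp: interval_dim_def)
    with 1 show ?thesis
      unfolding row_intervals.simps direct_sum_Cons IH rep by (intro eq_matI) auto
  next
    case 2
    then have "interval_dim ?p d = 1" "interval_dim ?p (d - 1) = 0"
      using l by (auto simp: interval_dim_def)
    with 2 show ?thesis
      unfolding row_intervals.simps direct_sum_Cons IH rep by (intro eq_matI) auto
  next
    case 3
    then have "interval_dim ?p d = 1" "interval_dim ?p (d - 1) = 1"
      using l by (auto simp: interval_dim_def)
    with 3 show ?thesis
      unfolding row_intervals.simps direct_sum_Cons IH rep by (intro eq_matI) auto
  next
    case 4
    then have "interval_dim ?p d = 0" "?n d = 0"
      using l intervals_dim_beyond_rows[of Y l d "Suc k"] by (auto simp: interval_dim_def)
    then show ?thesis
      unfolding row_intervals.simps direct_sum_Cons IH rep by (intro eq_matI) auto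
  qed
qed (auto simp: direct_sum_Nil intro!: eq_matI)

definition diagram_Down_rep :: "(int \<Rightarrow> nat) \<Rightarrow> rep" where
  "diagram_Down_rep v h = (if h \<in> Omega then diagram_rep v h else 0\<^sub>m (v (tgt h)) (v (src h)))"

lemma diagram_Down_rep_in_orbit:
  assumes "Y \<in> young_diagrams"
  shows "diagram_Down_rep (graded_dim (f_of Y)) \<in> orbit_of (graded_dim (f_of Y)) (f_of Y)"
proof -
  let ?v = "graded_dim (f_of Y)" and ?ps = "row_intervals 0 Y"
  have v: "intervals_dim ?ps = ?v"
    by (intro intervals_dim_eq_graded_dim allI count_list_row_intervals)
  have "direct_sum ?ps h = diagram_Down_rep ?v h" for h
    using direct_sum_row_intervals[OF assms, of 0]
    by (cases h) (simp_all add: diagram_Down_rep_def diagram_rep_def direct_sum_Up v)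
  then have "diagram_Down_rep ?v = rep_act (\<lambda>i. 1\<^sub>m (?v i)) (direct_sum ?ps)"
    using rep_act_one direct_sum_carrier[of ?ps] unfolding v by (metis ext)
  then show ?thesis
    using GV_one(1) count_list_row_intervals unfolding orbit_of_def by blast
qed

primrec down_comp :: "(int \<Rightarrow> nat) \<Rightarrow> rep \<Rightarrow> int \<Rightarrow> nat \<Rightarrow> complex mat" where
  "down_comp v x b 0 = 1\<^sub>m (v b)"
| "down_comp v x b (Suc n) = x (Down (b - int n)) * down_comp v x b n"

lemma Down_carrier_E: "x \<in> E v \<Longrightarrow> x (Down d) \<in> carrier_mat (v (d - 1)) (v d)"
  by (auto simp: E_def dest: spec[of _ "Down d"])

lemma down_comp_carrier:
  assumes "x \<in> E v" shows "down_comp v x b n \<in> carrier_mat (v (b - int n)) (v b)"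
proof (induction n)
  case (Suc n)
  have "b - int n - 1 = b - int (Suc n)" by simp
  with mult_carrier_mat[OF Down_carrier_E[OF assms, of "b - int n"] Suc] show ?case
    by (simp only: down_comp.simps)
qed simp

lemma interval_rep_carrier: "interval_rep p \<in> E (interval_dim p)"
  by (simp add: E_def interval_rep_def)

lemma down_comp_direct_sum_Cons:
  "down_comp (intervals_dim (p # ps)) (direct_sum (p # ps)) b n =
    four_block_mat (down_comp (interval_dim p) (interval_rep p) b n)
      (0\<^sub>m (interval_dim p (b - int n)) (intervals_dim ps b))
      (0\<^sub>m (intervals_dim ps (b - int n)) (interval_dim p b))
      (down_comp (intervals_dim ps) (direct_sum ps) b n)"
proof (induction n)
  case (Suc n)
  note c = Down_carrier_E[OF interval_rep_carrier, of p "b - int n"]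
    Down_carrier_E[OF direct_sum_carrier, of ps "b - int n"]
    down_comp_carrier[OF interval_rep_carrier, of p b n] down_comp_carrier[OF direct_sum_carrier, of ps b n]
  have d: "b - int (Suc n) = b - int n - 1" by simp
  let ?Z = "\<lambda>n m. 0\<^sub>m n m :: complex mat"
  have "down_comp (intervals_dim (p # ps)) (direct_sum (p # ps)) b (Suc n) =
    four_block_mat (interval_rep p (Down (b - int n)))
      (?Z (interval_dim p (b - int n - 1)) (intervals_dim ps (b - int n)))
      (?Z (intervals_dim ps (b - int n - 1)) (interval_dim p (b - int n)))
      (direct_sum ps (Down (b - int n))) *
    four_block_mat (down_comp (interval_dim p) (interval_rep p) b n)
      (?Z (interval_dim p (b - int n)) (intervals_dim ps b))
      (?Z (intervals_dim ps (b - int n)) (interval_dim p b))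
      (down_comp (intervals_dim ps) (direct_sum ps) b n)"
    by (simp only: down_comp.simps Suc.IH) (simp only: direct_sum_Cons src.simps tgt.simps)
  also have "\<dots> = four_block_mat
      (interval_rep p (Down (b - int n)) * down_comp (interval_dim p) (interval_rep p) b n)
      (?Z (interval_dim p (b - int n - 1)) (intervals_dim ps b))
      (?Z (intervals_dim ps (b - int n - 1)) (interval_dim p b))
      (direct_sum ps (Down (b - int n)) * down_comp (intervals_dim ps) (direct_sum ps) b n)"
    by (subst mult_four_block_mat[OF c(1) _ _ c(2) c(3) _ _ c(4)])
      (use c in \<open>auto simp: left_add_zero_mat[OF mult_carrier_mat[OF c(2,4)]] right_add_zero_mat[OF mult_carrier_mat[OF c(1,3)]]\<close>)
  finally show ?case
    by (simp only: down_comp.simps d)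
qed simp

lemma down_comp_direct_sum_eq_0:
  assumes "\<And>p. p \<in> set ps \<Longrightarrow> interval_dim p b = 0 \<or> interval_dim p (b - int n) = 0"
  shows "down_comp (intervals_dim ps) (direct_sum ps) b n = 0\<^sub>m (intervals_dim ps (b - int n)) (intervals_dim ps b)"
  using assms
proof (induction ps)
  case Nil
  show ?case
    by (intro empty_mat_eq_0 down_comp_carrier direct_sum_carrier) simp
next
  case (Cons p ps)
  have "down_comp (interval_dim p) (interval_rep p) b n = 0\<^sub>m (interval_dim p (b - int n)) (interval_dim p b)"
    using Cons.prems[of p] by (intro empty_mat_eq_0 down_comp_carrier interval_rep_carrier) auto
  moreover have "down_comp (intervals_dim ps) (direct_sum ps) b n = 0\<^sub>m (intervals_dim ps (b - int n)) (intervals_dim ps b)"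
    using Cons by simp
  ultimately show ?case
    unfolding down_comp_direct_sum_Cons by (intro eq_matI) auto
qed

lemma down_comp_rep_act:
  assumes g: "g \<in> GV v" and x: "x \<in> E v"
  shows "down_comp v (rep_act g x) b n * g b = g (b - int n) * down_comp v x b n"
proof (induction n)
  case 0
  show ?case using GV_carrier[OF g, of b] by simp
next
  case (Suc n)
  let ?d = "b - int n"
  note gc = GV_carrier[OF g] and ginv = GV_inverse[OF g]
  note xc = Down_carrier_E[OF x, of ?d] and cc = down_comp_carrier[OF x, of b n]
    and cc' = down_comp_carrier[OF rep_act_carrier[OF g x], of b n]
  have gx: "g (?d - 1) * x (Down ?d) \<in> carrier_mat (v (?d - 1)) (v ?d)"
    using gc xc by (rule mult_carrier_mat)
  have gC: "g ?d * down_comp v x b n \<in> carrier_mat (v ?d) (v b)"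
    using gc cc by (rule mult_carrier_mat)
  let ?h = "g (?d - 1) * x (Down ?d)"
  have "down_comp v (rep_act g x) b (Suc n) * g b =
      ?h * inv_at g ?d * down_comp v (rep_act g x) b n * g b"
    by (simp add: rep_act_def)
  also have "\<dots> = ?h * inv_at g ?d * (down_comp v (rep_act g x) b n * g b)"
    using mult_carrier_mat[OF gx ginv(1)] cc' gc by (rule assoc_mult_mat)
  also have "\<dots> = ?h * inv_at g ?d * (g ?d * down_comp v x b n)"
    by (simp only: Suc.IH)
  also have "\<dots> = ?h * (inv_at g ?d * (g ?d * down_comp v x b n))"
    using gx ginv(1) gC by (rule assoc_mult_mat)
  also have "inv_at g ?d * (g ?d * down_comp v x b n) = inv_at g ?d * g ?d * down_comp v x b n"
    using ginv(1) gc cc by (rule assoc_mult_mat[symmetric])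
  also have "\<dots> = down_comp v x b n"
    using ginv(3) cc by simp
  also have "?h * down_comp v x b n = g (?d - 1) * (x (Down ?d) * down_comp v x b n)"
    using gc xc cc by (rule assoc_mult_mat)
  finally show ?case by (simp add: diff_diff_eq add.commute)
qed

text \<open>
  On a direct sum of intervals a composite is block diagonal, and a block can be nonzero only if its interval
  meets both the first and the last degree. Conjugation by the group preserves vanishing.
\<close>

lemma down_comp_orbit_eq_0:
  assumes x: "x \<in> orbit_of (graded_dim f) f"
    and p: "\<And>p. f p \<noteq> 0 \<Longrightarrow> interval_dim p b = 0 \<or> interval_dim p (b - int n) = 0"
  shows "down_comp (graded_dim f) x b n = 0\<^sub>m (graded_dim f (b - int n)) (graded_dim f b)"
proof -
  let ?v = "graded_dim f"
  obtain g ps where g: "g \<in> GV ?v" and ps: "\<forall>p. count_list ps p = f p"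
    and x: "x = rep_act g (direct_sum ps)"
    using x by (auto simp: orbit_of_def)
  have v: "intervals_dim ps = ?v"
    using ps by (rule intervals_dim_eq_graded_dim)
  have E: "direct_sum ps \<in> E ?v"
    using direct_sum_carrier[of ps] by (simp add: v)
  let ?C = "down_comp ?v x b n"
  have C: "?C \<in> carrier_mat (?v (b - int n)) (?v b)"
    using down_comp_carrier[OF rep_act_carrier[OF g E]] by (simp add: x)
  have "p \<in> set ps \<Longrightarrow> f p \<noteq> 0" for p
    using ps by (metis count_list_0_iff)
  then have "down_comp ?v (direct_sum ps) b n = 0\<^sub>m (?v (b - int n)) (?v b)"
    unfolding v[symmetric] by (intro down_comp_direct_sum_eq_0 p)
  then have "?C * g b = 0\<^sub>m (?v (b - int n)) (?v b)"
    using down_comp_rep_act[OF g E, of b n] right_mult_zero_mat[OF GV_carrier[OF g]] by (simp add: x)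
  then have "?C * g b * inv_at g b = 0\<^sub>m (?v (b - int n)) (?v b)"
    using left_mult_zero_mat[OF GV_inverse(1)[OF g, of b]] by simp
  moreover have "?C * g b * inv_at g b = ?C * (g b * inv_at g b)"
    using C GV_carrier[OF g] GV_inverse(1)[OF g] by (rule assoc_mult_mat)
  ultimately show ?thesis
    using C GV_inverse(2)[OF g] by simp
qed

section \<open>Tangent vectors to the orbit\<close>

text \<open>
  The entry \<open>(a, \<beta>)\<close> of the composite \<open>down_comp v x b n\<close>, written out as a polynomial in the entries of \<open>x\<close>
  that makes sense for every family of matrices. The polynomial functions in the definition of
  the tangent space are functions on all families, including those of the wrong sizes.
\<close>

primrec down_entry :: "(int \<Rightarrow> nat) \<Rightarrow> int \<Rightarrow> nat \<Rightarrow> nat \<Rightarrow> nat \<Rightarrow> rep \<Rightarrow> complex" where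
  "down_entry v b \<beta> 0 a x = (if a = \<beta> then 1 else 0)"
| "down_entry v b \<beta> (Suc n) a x =
     (\<Sum>c<v (b - int n). x (Down (b - int n)) $$ (a, c) * down_entry v b \<beta> n c x)"

lemma poly_funs_sum:
  assumes "finite A" "\<And>i. i \<in> A \<Longrightarrow> F i \<in> poly_funs C"
  shows "(\<lambda>p. \<Sum>i\<in>A. F i p) \<in> poly_funs C"
  using assms by (induction rule: finite_induct) (auto intro: poly_funs.const poly_funs.add)

lemma down_entry_poly:
  "a < v (b - int n) \<Longrightarrow> (\<lambda>x. down_entry v b \<beta> n a x) \<in> poly_funs (rep_coords v)"
proof (induction n arbitrary: a)
  case (Suc n)
  have "(\<lambda>x. x (Down (b - int n)) $$ (a, c)) \<in> poly_funs (rep_coords v)" if "c < v (b - int n)" for c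
  proof (rule poly_funs.coord)
    have "a < v (b - int n - 1)" using Suc.prems by (simp add: algebra_simps)
    with that show "(\<lambda>x. x (Down (b - int n)) $$ (a, c)) \<in> rep_coords v"
      unfolding rep_coords_def by (intro CollectI exI[of _ "Down (b - int n)"] exI[of _ a] exI[of _ c]) auto
  qed
  then show ?case
    unfolding down_entry.simps by (intro poly_funs_sum poly_funs.mult Suc.IH) auto
next
  case 0
  have "(\<lambda>x. down_entry v b \<beta> 0 a x) = (\<lambda>_. if a = \<beta> then 1 else 0)"
    by (rule ext) simp
  then show ?case by (simp only: poly_funs.const)
qed

lemma down_entry_eq_down_comp:
  assumes x: "x \<in> E v" and \<beta>: "\<beta> < v b"
  shows "a < v (b - int n) \<Longrightarrow> down_entry v b \<beta> n a x = down_comp v x b n $$ (a, \<beta>)"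
proof (induction n arbitrary: a)
  case (Suc n)
  have "a < v (b - int n - 1)" using Suc.prems by (simp add: algebra_simps)
  then have "down_comp v x b (Suc n) $$ (a, \<beta>) = 
      (\<Sum>c\<in>{0..<v (b - int n)}. x (Down (b - int n)) $$ (a, c) * down_comp v x b n $$ (c, \<beta>))"
    using Down_carrier_E[OF x, of "b - int n"] down_comp_carrier[OF x, of b n] \<beta>
    by (simp add: scalar_prod_def)
  then show ?case
    using Suc.IH by (simp add: lessThan_atLeast0)
qed (use \<beta> in simp)

text \<open>
  The derivative of \<open>down_entry\<close> at \<open>x\<close> in the direction \<open>t\<close>, by the product rule.
\<close>

primrec down_deriv :: "(int \<Rightarrow> nat) \<Rightarrow> rep \<Rightarrow> rep \<Rightarrow> int \<Rightarrow> nat \<Rightarrow> nat \<Rightarrow> nat \<Rightarrow> complex" where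
  "down_deriv v x t b \<beta> 0 a = 0"
| "down_deriv v x t b \<beta> (Suc n) a =
     (\<Sum>c<v (b - int n). t (Down (b - int n)) $$ (a, c) * down_entry v b \<beta> n c x +
        x (Down (b - int n)) $$ (a, c) * down_deriv v x t b \<beta> n c)"

lemma down_entry_has_derivative:
  assumes x: "x \<in> E v" and t: "t \<in> E v"
  shows "a < v (b - int n) \<Longrightarrow>
    ((\<lambda>z. down_entry v b \<beta> n a (\<lambda>h. x h + z \<cdot>\<^sub>m t h)) has_field_derivative down_deriv v x t b \<beta> n a) (at 0)"
proof (induction n arbitrary: a)
  case (Suc n)
  let ?d = "b - int n"
  have a: "a < v (?d - 1)" using Suc.prems by (simp add: algebra_simps)
  note c = Down_carrier_E[OF x, of ?d] Down_carrier_E[OF t, of ?d]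
  have "x h + 0 \<cdot>\<^sub>m t h = x h" for h
  proof -
    have "x h \<in> carrier_mat (v (tgt h)) (v (src h))" "t h \<in> carrier_mat (v (tgt h)) (v (src h))"
      using x t by (auto simp: E_def)
    then show ?thesis by (intro eq_matI) auto
  qed
  then have x0: "(\<lambda>h. x h + 0 \<cdot>\<^sub>m t h) = x" by blast
  have entry: "(x (Down ?d) + z \<cdot>\<^sub>m t (Down ?d)) $$ (a, k) = x (Down ?d) $$ (a, k) + z * t (Down ?d) $$ (a, k)"
    if "k < v ?d" for k z
    using a that c by simp
  \<comment> \<open>The terms with factor \<open>0\<close> come from evaluating the product rule at \<open>z = 0\<close>.\<close>
  have "((\<lambda>z. \<Sum>k<v ?d. (x (Down ?d) $$ (a, k) + z * t (Down ?d) $$ (a, k)) *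
      down_entry v b \<beta> n k (\<lambda>h. x h + z \<cdot>\<^sub>m t h)) has_field_derivative
    (\<Sum>k<v ?d. t (Down ?d) $$ (a, k) * down_entry v b \<beta> n k (\<lambda>h. x h + 0 \<cdot>\<^sub>m t h) +
      (x (Down ?d) $$ (a, k) + 0 * t (Down ?d) $$ (a, k)) * down_deriv v x t b \<beta> n k)) (at 0)"
  proof (rule DERIV_sum)
    fix k assume "k \<in> {..<v ?d}"
    then have k: "k < v ?d" by simp
    have "((\<lambda>z. x (Down ?d) $$ (a, k) + z * t (Down ?d) $$ (a, k)) has_field_derivative t (Down ?d) $$ (a, k)) (at 0)"
      by (auto intro!: derivative_eq_intros)
    from DERIV_mult[OF this Suc.IH[OF k]]
    show "((\<lambda>z. (x (Down ?d) $$ (a, k) + z * t (Down ?d) $$ (a, k)) *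
      down_entry v b \<beta> n k (\<lambda>h. x h + z \<cdot>\<^sub>m t h)) has_field_derivative
        t (Down ?d) $$ (a, k) * down_entry v b \<beta> n k (\<lambda>h. x h + 0 \<cdot>\<^sub>m t h) +
      (x (Down ?d) $$ (a, k) + 0 * t (Down ?d) $$ (a, k)) * down_deriv v x t b \<beta> n k) (at 0)"
      by (simp only: mult.commute add.commute)
  qed
  then show ?case
    using entry by (simp add: x0)
qed simp

lemma Down_row_entry:
  assumes v: "v = graded_dim (f_of Y)" and d: "d = int c - int r" and a: "a < v (d - 1)" and k: "k < v d"
    and c: "0 < c" "k = min r c"
  shows "diagram_Down_rep v (Down d) $$ (a, k) = (if a = min r (c - 1) then 1 else 0)"
  using assms by (auto simp: diagram_Down_rep_def diagram_rep_def min_def)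

context
  fixes Y :: "nat list" and v :: "int \<Rightarrow> nat" and t :: rep and r :: nat
  assumes Y: "Y \<in> young_diagrams" and v: "v = graded_dim (f_of Y)"
    and r: "Suc r < length Y"
begin

lemma box_less: "in_diagram Y i c \<Longrightarrow> d = int c - int i \<Longrightarrow> min i c < v d"
  using in_diagram_iff_less_graded_dim[OF Y] by (simp add: v)

lemma upper_row: "c < Y ! Suc r \<Longrightarrow> in_diagram Y r c"
  using in_diagram_antimono[OF Y, of "Suc r" c r c] r by (simp add: in_diagram_def)

lemma lower_row: "c < Y ! Suc r \<Longrightarrow> in_diagram Y (Suc r) c"
  using r by (simp add: in_diagram_def)

text \<open>
  The composite carries the box of row \<open>r\<close> above the last box of the next row to the left along row \<open>r\<close>.
\<close>

lemma down_entry_row: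
  assumes "n < Y ! Suc r" "a < v (int (Y ! Suc r) - 1 - int r - int n)"
  shows "down_entry v (int (Y ! Suc r) - 1 - int r) (min r (Y ! Suc r - 1)) n a (diagram_Down_rep v) =
    (if a = min r (Y ! Suc r - 1 - n) then 1 else 0)"
  using assms
proof (induction n arbitrary: a)
  case (Suc n)
  let ?d = "int (Y ! Suc r) - 1 - int r - int n" and ?k = "min r (Y ! Suc r - 1 - n)"
  have k: "?k < v ?d"
    using Suc.prems by (intro box_less upper_row) auto
  have "down_entry v (int (Y ! Suc r) - 1 - int r) (min r (Y ! Suc r - 1)) (Suc n) a (diagram_Down_rep v) =
    (\<Sum>c<v ?d. diagram_Down_rep v (Down ?d) $$ (a, c) * (if c = ?k then 1 else 0))"
    using Suc by simp
  also have "\<dots> = (\<Sum>c<v ?d. if c = ?k then diagram_Down_rep v (Down ?d) $$ (a, c) else 0)"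
    by (intro sum.cong) auto
  also have "\<dots> = diagram_Down_rep v (Down ?d) $$ (a, ?k)"
    using k by simp
  also have "\<dots> = (if a = min r (Y ! Suc r - 1 - n - 1) then 1 else 0)"
    using Suc.prems k by (intro Down_row_entry[OF v]) (auto simp: algebra_simps)
  finally show ?case by simp
qed simp

lemma Down_row_entry_lower:
  assumes "d = int c - int (Suc r)" "k < v d" "c \<le> Y ! Suc r" "0 < c"
  shows "diagram_Down_rep v (Down d) $$ (min (Suc r) (c - 1), k) = (if k = min (Suc r) c then 1 else 0)"
proof -
  have "min (Suc r) (c - 1) < v (d - 1)"
    using assms by (intro box_less lower_row) auto
  then show ?thesis
    using assms by (auto simp: diagram_Down_rep_def diagram_rep_def min_def)
qed

text \<open>
  A contribution to the derivative moves left along row \<open>r\<close>, changes to row \<open>Suc r\<close> once by an entry of \<open>t\<close>,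
  and moves on to the left along row \<open>Suc r\<close>.
\<close>

lemma down_deriv_row:
  assumes "n \<le> Y ! Suc r"
  shows "down_deriv v (diagram_Down_rep v) t (int (Y ! Suc r) - 1 - int r) (min r (Y ! Suc r - 1)) n (min (Suc r) (Y ! Suc r - n)) =
    (\<Sum>m<n. t (Down (int (Y ! Suc r - 1 - m) - int r)) $$ (min (Suc r) (Y ! Suc r - 1 - m), min r (Y ! Suc r - 1 - m)))"
  using assms
proof (induction n)
  case (Suc n)
  let ?d = "int (Y ! Suc r) - 1 - int r - int n" and ?a = "min (Suc r) (Y ! Suc r - Suc n)"
  let ?D = "down_deriv v (diagram_Down_rep v) t (int (Y ! Suc r) - 1 - int r) (min r (Y ! Suc r - 1)) n"
  let ?k = "min r (Y ! Suc r - 1 - n)" and ?l = "min (Suc r) (Y ! Suc r - n)"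
  have k: "?k < v ?d"
    using Suc.prems by (intro box_less upper_row) auto
  have "down_deriv v (diagram_Down_rep v) t (int (Y ! Suc r) - 1 - int r) (min r (Y ! Suc r - 1)) (Suc n) ?a =
    (\<Sum>c<v ?d. (if c = ?k then t (Down ?d) $$ (?a, c) else 0) + (if c = ?l then ?D c else 0))"
    unfolding down_deriv.simps
  proof (intro sum.cong refl arg_cong2[of _ _ _ _ "(+)"])
    fix c assume "c \<in> {..<v ?d}"
    then have c: "c < v ?d" by simp
    show "t (Down ?d) $$ (?a, c) * down_entry v (int (Y ! Suc r) - 1 - int r) (min r (Y ! Suc r - 1)) n c (diagram_Down_rep v) =
      (if c = ?k then t (Down ?d) $$ (?a, c) else 0)"
      using down_entry_row[of n c] Suc.prems c by simp
    have "diagram_Down_rep v (Down ?d) $$ (min (Suc r) (Y ! Suc r - n - 1), c) = (if c = ?l then 1 else 0)"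
      using Suc.prems c by (intro Down_row_entry_lower) auto
    then show "diagram_Down_rep v (Down ?d) $$ (?a, c) * ?D c = (if c = ?l then ?D c else 0)"
      by simp
  qed
  also have "\<dots> = t (Down ?d) $$ (?a, ?k) + (if ?l < v ?d then ?D ?l else 0)"
    using k by (simp add: sum.distrib)
  \<comment> \<open>For \<open>n = 0\<close> the box \<open>?l\<close> lies beyond the end of row \<open>Suc r\<close>, but then the derivative is zero.\<close>
  also have "(if ?l < v ?d then ?D ?l else 0) = ?D ?l"
  proof (cases n)
    case (Suc m)
    then have "?l < v ?d"
      using Suc.prems by (intro box_less lower_row) auto
    then show ?thesis by simp
  qed simp
  also have "t (Down ?d) $$ (?a, ?k) + ?D ?l =
    (\<Sum>m<Suc n. t (Down (int (Y ! Suc r - 1 - m) - int r)) $$ (min (Suc r) (Y ! Suc r - 1 - m), min r (Y ! Suc r - 1 - m)))"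
  proof -
    have d: "?d = int (Y ! Suc r - 1 - n) - int r" using Suc.prems by (simp add: of_nat_diff)
    have "t (Down ?d) $$ (?a, ?k) =
        t (Down (int (Y ! Suc r - 1 - n) - int r)) $$ (min (Suc r) (Y ! Suc r - 1 - n), ?k)"
      unfolding d by simp
    moreover have "n \<le> Y ! Suc r" using Suc.prems by simp
    ultimately show ?thesis
      by (simp only: Suc.IH sum.lessThan_Suc add.commute)
  qed
  finally show ?case .
qed simp

lemma tangent_row_sum_eq_0:
  assumes t: "t \<in> tangent_space v (orbit_of v (f_of Y)) (diagram_Down_rep v)"
  shows "(\<Sum>c<Y ! Suc r. t (Down (int c - int r)) $$ (min (Suc r) c, min r c)) = 0"
proof -
  let ?b = "int (Y ! Suc r) - 1 - int r" and ?\<beta> = "min r (Y ! Suc r - 1)"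
  let ?x = "diagram_Down_rep v"
  have L: "0 < Y ! Suc r" using Y r by (auto simp: young_diagrams_def)
  have tE: "t \<in> E v" using t by (simp add: tangent_space_def)
  have xE: "?x \<in> E v"
    using diagram_rep_carrier[of v] by (auto simp: diagram_Down_rep_def E_def)
  have \<beta>: "?\<beta> < v ?b"
    using L by (intro box_less upper_row) (auto simp: of_nat_diff)
  have a: "0 < v (?b - int (Y ! Suc r))"
    using box_less[OF lower_row[OF L], of "- 1 - int r"] by simp
  have "down_entry v ?b ?\<beta> (Y ! Suc r) 0 q = 0" if q: "q \<in> orbit_of v (f_of Y)" for q
  proof -
    have "interval_dim p ?b = 0 \<or> interval_dim p (?b - int (Y ! Suc r)) = 0" if "f_of Y p \<noteq> 0" for p
    proof -
      obtain i where i: "i < length Y" and p: "p = row_interval Y i"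
        using \<open>f_of Y p \<noteq> 0\<close> by (auto simp: f_of_def A_of_eq split: if_splits)
      \<comment> \<open>An interval meeting both end degrees would belong to a row below row \<open>r\<close> and longer than row \<open>Suc r\<close>.\<close>
      have "Y ! i \<le> Y ! Suc r" if "Suc r \<le> i"
        using that i Y by (cases "i = Suc r") (auto simp: young_diagrams_def sorted_wrt_iff_nth_less)
      then show ?thesis
        by (cases "Suc r \<le> i") (auto simp: p interval_dim_def row_interval_def)
    qed
    then have "down_comp v q ?b (Y ! Suc r) = 0\<^sub>m (v (?b - int (Y ! Suc r))) (v ?b)"
      using down_comp_orbit_eq_0[of q "f_of Y" ?b "Y ! Suc r"] q by (simp add: v)
    moreover have "q \<in> E v"
    proof -
      obtain g ps where "g \<in> GV v" "\<forall>p. count_list ps p = f_of Y p" "q = rep_act g (direct_sum ps)"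
        using q by (auto simp: orbit_of_def)
      then show ?thesis
        using rep_act_carrier[of g v "direct_sum ps"] direct_sum_carrier[of ps]
          intervals_dim_eq_graded_dim[of ps "f_of Y"] by (simp add: v)
    qed
    ultimately show ?thesis
      using down_entry_eq_down_comp[OF _ \<beta> a] a \<beta> by simp
  qed
  then have "((\<lambda>z. down_entry v ?b ?\<beta> (Y ! Suc r) 0 (\<lambda>h. ?x h + z \<cdot>\<^sub>m t h)) has_field_derivative 0) (at 0)"
    using t down_entry_poly[where n="Y ! Suc r" and v=v and b="?b" and a=0 and \<beta>="?\<beta>", OF a] unfolding tangent_space_def by blast
  then have "down_deriv v ?x t ?b ?\<beta> (Y ! Suc r) 0 = 0"
    using down_entry_has_derivative[OF xE tE a] DERIV_unique by blast
  then have "(\<Sum>m<Y ! Suc r. t (Down (int (Y ! Suc r - 1 - m) - int r)) $$ (min (Suc r) (Y ! Suc r - 1 - m), min r (Y ! Suc r - 1 - m))) = 0"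
    using down_deriv_row[of "Y ! Suc r"] by simp
  then show ?thesis
    using sum.nat_diff_reindex[of "\<lambda>c. t (Down (int c - int r)) $$ (min (Suc r) c, min r c)" "Y ! Suc r"] by simp
qed

end

section \<open>The conormal bundle contains the point\<close>

definition diagram_Up_rep :: "(int \<Rightarrow> nat) \<Rightarrow> rep" where
  "diagram_Up_rep v h = (if h \<in> Omega_bar then diagram_rep v h else 0\<^sub>m (v (tgt h)) (v (src h)))"

lemma Omega_bar_simps [simp]: "Up d \<in> Omega_bar" "Down d \<notin> Omega_bar"
  by (auto simp: Omega_bar_def)

lemma diagram_rep_split: "(\<lambda>h. diagram_Down_rep v h + diagram_Up_rep v h) = diagram_rep v"
proof
  fix h show "diagram_Down_rep v h + diagram_Up_rep v h = diagram_rep v h"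
    by (cases h; intro eq_matI) (simp_all add: diagram_Down_rep_def diagram_Up_rep_def)
qed

lemma diagram_Up_rep_carrier: "diagram_Up_rep v \<in> E_on Omega_bar v"
  using diagram_rep_carrier[of v] by (auto simp: E_on_def E_def diagram_Up_rep_def)

text \<open>
  A step up in the diagram is the same as a box \<open>(Suc r, c)\<close> outside the first row. The sum over these boxes is
  grouped by degree on the left-hand side and by row on the right-hand side.
\<close>

lemma sum_over_diagram:
  assumes Y: "Y \<in> young_diagrams" and v: "v = graded_dim (f_of Y)"
  shows "(\<Sum>d | v d \<noteq> 0. \<Sum>a<v (d - 1). \<Sum>c<v d. if diagram_step (Up d) c a then F d a c else 0) =
    (\<Sum>r | Suc r < length Y. \<Sum>c<Y ! Suc r. F (int c - int r) (min (Suc r) c) (min r c))"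
    (is "?lhs = ?rhs")
proof -
  have fin: "finite {d. v d \<noteq> 0}"
    using graded_dim_graded_dims[OF Y] by (simp add: v graded_dims_def)
  note box = in_diagram_iff_less_graded_dim[OF Y, folded v]
  let ?T = "SIGMA d:{d. v d \<noteq> 0}. {..<v (d - 1)} \<times> {..<v d}"
  let ?Q = "SIGMA r:{r. Suc r < length Y}. {..<Y ! Suc r}"
  let ?\<iota> = "\<lambda>(r, c). (int c - int r, min (Suc r) c, min r c)"
  have Q: "(r, c) \<in> ?Q \<longleftrightarrow> in_diagram Y (Suc r) c" for r c
    by (auto simp: in_diagram_def)
  have finT: "finite ?T" using fin by auto
  have "?lhs = (\<Sum>(d, a, c)\<in>?T. if diagram_step (Up d) c a then F d a c else 0)"
    using fin by (simp add: sum.Sigma sum.cartesian_product)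
  also have "\<dots> = (\<Sum>(d, a, c)\<in>{(d, a, c) \<in> ?T. diagram_step (Up d) c a}. F d a c)"
    using finT by (intro sum.mono_neutral_cong_right) (auto split: if_splits)
  also have "{(d, a, c) \<in> ?T. diagram_step (Up d) c a} = ?\<iota> ` ?Q"
  proof (intro subset_antisym subsetI)
    fix z assume "z \<in> {(d, a, c) \<in> ?T. diagram_step (Up d) c a}"
    then obtain d a c where z: "z = (d, a, c)" "a < v (d - 1)" "c < v d" "diagram_step (Up d) c a"
      by auto
    let ?r = "c + nat (- d)" and ?c = "c + nat d"
    have *: "min (Suc ?r) ?c = a" "int ?c - int (Suc ?r) = d - 1" "min ?r ?c = c" "int ?c - int ?r = d"
      using z(4) by (auto split: if_splits)
    have "(?r, ?c) \<in> ?Q"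
      unfolding Q box * by (rule z(2))
    moreover have "z = ?\<iota> (?r, ?c)"
      unfolding z(1) prod.case * ..
    ultimately show "z \<in> ?\<iota> ` ?Q" by blast
  next
    fix z assume "z \<in> ?\<iota> ` ?Q"
    then obtain r c where z: "z = ?\<iota> (r, c)" and "(r, c) \<in> ?Q" by auto
    then have lower: "in_diagram Y (Suc r) c" using Q by blast
    then have upper: "in_diagram Y r c" by (rule in_diagram_antimono[OF Y]) auto
    have *: "int c - int (Suc r) = int c - int r - 1" by simp
    have "min (Suc r) c < v (int c - int r - 1)"
      using lower unfolding box * .
    moreover have "min r c < v (int c - int r)"
      using upper unfolding box .
    ultimately show "z \<in> {(d, a, c) \<in> ?T. diagram_step (Up d) c a}"
      unfolding z by (simp add: min_def)
  qed
  also have "(\<Sum>(d, a, c)\<in>?\<iota> ` ?Q. F d a c) = (\<Sum>(r, c)\<in>?Q. F (int c - int r) (min (Suc r) c) (min r c))"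
  proof (subst sum.reindex)
    show "inj_on ?\<iota> ?Q" by (auto simp: inj_on_def min_def split: if_splits)
  qed (simp add: o_def case_prod_unfold)
  also have "\<dots> = ?rhs"
  proof (rule sum.Sigma[symmetric])
    show "finite {r. Suc r < length Y}" by (rule finite_subset[of _ "{..<length Y}"]) auto
  qed simp
  finally show ?thesis .
qed

lemma pairing_diagram_Up_rep:
  assumes t: "t \<in> E v"
  shows "pairing v t (diagram_Up_rep v) =
    (\<Sum>d | v d \<noteq> 0. \<Sum>a<v (d - 1). \<Sum>c<v d. if diagram_step (Up d) c a then t (Down d) $$ (a, c) else 0)"
proof -
  let ?g = "\<lambda>h. eps h * mat_trace (t h * diagram_Up_rep v (opp h))"
  have Up: "?g (Up d) = 0" for d
  proof -
    have "t (Up d) \<in> carrier_mat (v d) (v (d - 1))"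
      using t by (auto simp: E_def dest: spec[of _ "Up d"])
    then show ?thesis by (simp add: mat_trace_def diagram_Up_rep_def)
  qed
  have Down: "?g (Down d) = (\<Sum>a<v (d - 1). \<Sum>c<v d. if diagram_step (Up d) c a then t (Down d) $$ (a, c) else 0)" for d
  proof -
    note c = Down_carrier_E[OF t, of d]
    have "(t (Down d) * diagram_Up_rep v (Up d)) $$ (a, a) =
      (\<Sum>c<v d. if diagram_step (Up d) c a then t (Down d) $$ (a, c) else 0)" if a: "a < v (d - 1)" for a
    proof -
      have "(t (Down d) * diagram_Up_rep v (Up d)) $$ (a, a) =
        (\<Sum>c\<in>{0..<v d}. t (Down d) $$ (a, c) * (if diagram_step (Up d) c a then 1 else 0))"
        using c a by (simp add: scalar_prod_def diagram_Up_rep_def diagram_rep_def)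
      also have "\<dots> = (\<Sum>c<v d. if diagram_step (Up d) c a then t (Down d) $$ (a, c) else 0)"
        unfolding lessThan_atLeast0 by (intro sum.cong) auto
      finally show ?thesis .
    qed
    moreover have "dim_row (t (Down d)) = v (d - 1)" using c by simp
    ultimately show ?thesis
      by (simp add: mat_trace_def del: diagram_step.simps)
  qed
  have "pairing v t (diagram_Up_rep v) = (\<Sum>h | v (src h) \<noteq> 0. ?g h)"
    by (simp add: pairing_def)
  also have "\<dots> = (\<Sum>h\<in>Down ` {d. v d \<noteq> 0}. ?g h)"
  proof (cases "finite {d. v d \<noteq> 0}")
    case True
    have "{h. v (src h) \<noteq> 0} \<subseteq> Down ` {d. v d \<noteq> 0} \<union> (\<lambda>d. Up (d + 1)) ` {d. v d \<noteq> 0}"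
    proof
      fix h assume "h \<in> {h. v (src h) \<noteq> 0}"
      then show "h \<in> Down ` {d. v d \<noteq> 0} \<union> (\<lambda>d. Up (d + 1)) ` {d. v d \<noteq> 0}"
        by (cases h) (auto intro: rev_image_eqI[of "_ - 1"])
    qed
    then have "finite {h. v (src h) \<noteq> 0}"
      using True by (meson finite_UnI finite_imageI finite_subset)
    then show ?thesis
    proof (intro sum.mono_neutral_right ballI)
      fix h assume "h \<in> {h. v (src h) \<noteq> 0} - Down ` {d. v d \<noteq> 0}"
      then show "?g h = 0" using Up by (cases h) auto
    qed auto
  next
    case False
    then have "infinite (Down ` {d. v d \<noteq> 0})"
      by (simp add: finite_image_iff inj_on_def)
    moreover have "Down ` {d. v d \<noteq> 0} \<subseteq> {h. v (src h) \<noteq> 0}" by auto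
    ultimately have "infinite {h. v (src h) \<noteq> 0}"
      using finite_subset by blast
    then show ?thesis
      using \<open>infinite (Down ` {d. v d \<noteq> 0})\<close> by (simp only: sum.infinite not_False_eq_True)
  qed
  also have "\<dots> = (\<Sum>d | v d \<noteq> 0. ?g (Down d))"
  proof -
    have "inj_on Down {d. v d \<noteq> 0}" by (simp add: inj_on_def)
    then show ?thesis by (simp only: sum.reindex o_def)
  qed
  finally show ?thesis
    by (simp only: Down)
qed

lemma diagram_rep_conormal:
  assumes Y: "Y \<in> young_diagrams" and v: "v = graded_dim (f_of Y)"
  shows "diagram_rep v \<in> conormal v (f_of Y)"
proof -
  have "pairing v t (diagram_Up_rep v) = 0"
    if t: "t \<in> tangent_space v (orbit_of v (f_of Y)) (diagram_Down_rep v)" for t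
  proof -
    have "t \<in> E v" using t by (simp add: tangent_space_def)
    then have "pairing v t (diagram_Up_rep v) =
      (\<Sum>r | Suc r < length Y. \<Sum>c<Y ! Suc r. t (Down (int c - int r)) $$ (min (Suc r) c, min r c))"
      using pairing_diagram_Up_rep sum_over_diagram[OF Y v, of "\<lambda>d a c. t (Down d) $$ (a, c)"] by simp
    also have "\<dots> = 0"
      using tangent_row_sum_eq_0[OF Y v _ t] by (intro sum.neutral) auto
    finally show ?thesis .
  qed
  moreover have "diagram_Down_rep v \<in> orbit_of v (f_of Y)"
    using diagram_Down_rep_in_orbit[OF Y] by (simp add: v)
  ultimately show ?thesis
    using diagram_Up_rep_carrier[of v] diagram_rep_split[of v, symmetric] unfolding conormal_def by blast
qed

lemma diagram_rep_conormal_closure: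
  assumes Y: "Y \<in> young_diagrams" and v: "v = graded_dim (f_of Y)"
  shows "diagram_rep v \<in> conormal_closure v (f_of Y)"
  unfolding conormal_closure_def
  by (rule subsetD[OF closure_of_subset_Int])
    (simp add: topspace_zariski diagram_rep_conormal[OF Y v] diagram_rep_carrier)

section \<open>The irreducible components\<close>

definition diagram_point :: "(int \<Rightarrow> nat) \<Rightarrow> (rep \<times> gmat) set" where
  "diagram_point v = framed_orbit v (diagram_rep v, diagram_framing v)"

lemma framed_orbit_eq_diagram_point:
  assumes p: "p \<in> Lam_st v w0"
  shows "staircase v" "framed_orbit v p = diagram_point v"
proof -
  obtain x j where xj: "p = (x, j)" by (cases p)
  have x: "x \<in> Lam v" and j: "j \<in> homVW v w0" and st: "stable v w0 (x, j)"
    using p by (auto simp: Lam_st_def xj)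
  show "staircase v" by (rule staircase_dimension[OF x j st])
  have "p \<in> E v \<times> homVW v w0" using x j by (simp add: xj Lam_def)
  from framed_orbit_act[OF covector_frame_GV[OF x j st] this]
  show "framed_orbit v p = diagram_point v"
    using covector_frame_act[OF x j st] by (simp add: xj diagram_point_def)
qed

lemma topspace_Lvar: "topspace (Lvar v w) = framed_orbit v ` Lam_st v w"
proof -
  have "Lam_st v w \<subseteq> E v \<times> homVW v w"
    by (auto simp: Lam_st_def Lam_def)
  then have "topspace (subtopology (zariski (framed_coords v w) (E v \<times> homVW v w)) (Lam_st v w)) = Lam_st v w"
    by (auto simp: topspace_zariski)
  then show ?thesis
    using quotient_imp_surjective_map[OF quotient_map_quotient_topology] unfolding Lvar_def by metis
qed

lemma topspace_Lvar_w0: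
  assumes v: "v \<in> graded_dims"
  shows "topspace (Lvar v w0) = (if staircase v then {diagram_point v} else {})"
proof (cases "staircase v")
  case True
  then have "(diagram_rep v, diagram_framing v) \<in> Lam_st v w0"
    by (rule diagram_rep_Lam_st[OF v])
  then show ?thesis
    using True framed_orbit_eq_diagram_point(2)[of _ v] unfolding topspace_Lvar by auto
next
  case False
  then show ?thesis
    using framed_orbit_eq_diagram_point(1)[of _ v] unfolding topspace_Lvar by auto
qed

lemma irreducible_components_singleton:
  assumes "topspace X = {p}" shows "irreducible_components X = {{p}}"
proof -
  have "irreducible_in X S \<longleftrightarrow> S = {p}" for S
    using assms unfolding irreducible_in_def by blast
  then show ?thesis
    unfolding irreducible_components_def by auto
qed

lemma irreducible_components_empty:
  assumes "topspace X = {}" shows "irreducible_components X = {}"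
  using assms unfolding irreducible_components_def irreducible_in_def by auto

lemma Xf_eq_diagram_point:
  assumes Y: "Y \<in> young_diagrams" and v: "v = graded_dim (f_of Y)"
  shows "Xf v w0 (f_of Y) = {diagram_point v}"
proof -
  have vd: "v \<in> graded_dims" "staircase v"
    using graded_dim_graded_dims[OF Y] graded_dim_staircase[OF Y] by (simp_all add: v)
  have "Xf v w0 (f_of Y) \<subseteq> {diagram_point v}"
    using framed_orbit_eq_diagram_point(2)[of _ v] unfolding Xf_def by auto
  moreover have "diagram_point v \<in> Xf v w0 (f_of Y)"
    using diagram_rep_conormal_closure[OF Y v] diagram_framing_carrier[of v] diagram_rep_Lam_st[OF vd]
    unfolding Xf_def diagram_point_def by blast
  ultimately show ?thesis by blast
qed

lemma irreducible_components_Lvar_w0: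
  assumes v: "v \<in> graded_dims"
  shows "irreducible_components (Lvar v w0) = (if staircase v then {{diagram_point v}} else {})"
proof (cases "staircase v")
  case True
  then have "topspace (Lvar v w0) = {diagram_point v}"
    using topspace_Lvar_w0[OF v] by (simp only: if_True)
  then show ?thesis
    using True irreducible_components_singleton by (simp only: if_True)
next
  case False
  then have "topspace (Lvar v w0) = {}"
    using topspace_Lvar_w0[OF v] by (simp only: if_False)
  then show ?thesis
    using False irreducible_components_empty by (simp only: if_False)
qed

theorem theorem4p1p1:
  shows "(\<forall>v \<in> graded_dims.
            irreducible_components (Lvar v w0) =
              {Xf v w0 f | f. f \<in> Ztilde_of v \<and>
                 (\<exists>Y \<in> young_diagrams. {p. f p = 1} = A_of Y \<and> (\<forall>p. p \<notin> A_of Y \<longrightarrow> f p = 0))})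
       \<and> bij_betw (\<lambda>Y. (graded_dim (f_of Y), X_of Y)) young_diagrams
           (SIGMA v : graded_dims. irreducible_components (Lvar v w0))"
proof (intro conjI ballI)
  fix v assume v: "v \<in> graded_dims"
  let ?Xs = "{Xf v w0 f | f. f \<in> Ztilde_of v \<and> (\<exists>Y\<in>young_diagrams. f = f_of Y)}"
  have dim: "v = graded_dim (f_of Y)" if "f_of Y \<in> Ztilde_of v" for Y
    using that by (auto simp: Ztilde_of_def)
  have subset: "S = {diagram_point v} \<and> staircase v" if S: "S \<in> ?Xs" for S
  proof -
    obtain Y where Y: "Y \<in> young_diagrams" "f_of Y \<in> Ztilde_of v" and S: "S = Xf v w0 (f_of Y)"
      using S by blast
    have "staircase v"
      using graded_dim_staircase[OF Y(1)] dim[OF Y(2)] by simp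
    then show ?thesis
      using Xf_eq_diagram_point[OF Y(1) dim[OF Y(2)]] S by simp
  qed
  have "{diagram_point v} \<in> ?Xs" if stair: "staircase v"
  proof -
    obtain Y where Y: "Y \<in> young_diagrams" "graded_dim (f_of Y) = v"
      using staircase_young_diagram[OF v stair] by blast
    then have "f_of Y \<in> Ztilde_of v" "Xf v w0 (f_of Y) = {diagram_point v}"
      using f_of_Ztilde[of Y] Xf_eq_diagram_point[of Y v] by simp_all
    then show ?thesis using Y(1) by blast
  qed
  then have one: "staircase v \<Longrightarrow> ?Xs = {{diagram_point v}}"
    and none: "\<not> staircase v \<Longrightarrow> ?Xs = {}"
    using subset by blast+
  have Xs: "?Xs = (if staircase v then {{diagram_point v}} else {})"
  proof (cases "staircase v")
    case True
    then show ?thesis using one[OF True] by (simp only: if_True)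
  next
    case False
    then show ?thesis using none[OF False] by (simp only: if_False)
  qed
  show "irreducible_components (Lvar v w0) =
      {Xf v w0 f | f. f \<in> Ztilde_of v \<and>
         (\<exists>Y \<in> young_diagrams. {p. f p = 1} = A_of Y \<and> (\<forall>p. p \<notin> A_of Y \<longrightarrow> f p = 0))}"
    unfolding f_of_unique Xs by (rule irreducible_components_Lvar_w0[OF v])
next
  have X: "X_of Y = {diagram_point (graded_dim (f_of Y))}" if "Y \<in> young_diagrams" for Y
    using Xf_eq_diagram_point[OF that refl] by (simp add: X_of_def)
  show "bij_betw (\<lambda>Y. (graded_dim (f_of Y), X_of Y)) young_diagrams
      (SIGMA v : graded_dims. irreducible_components (Lvar v w0))"
    unfolding bij_betw_def
  proof (intro conjI subset_antisym subsetI)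
    show "inj_on (\<lambda>Y. (graded_dim (f_of Y), X_of Y)) young_diagrams"
      using graded_dim_inj by (auto simp: inj_on_def)
  next
    fix z assume "z \<in> (\<lambda>Y. (graded_dim (f_of Y), X_of Y)) ` young_diagrams"
    then show "z \<in> (SIGMA v : graded_dims. irreducible_components (Lvar v w0))"
      using graded_dim_graded_dims graded_dim_staircase
      by (auto simp: X irreducible_components_Lvar_w0)
  next
    fix z assume "z \<in> (SIGMA v : graded_dims. irreducible_components (Lvar v w0))"
    then obtain v where v: "v \<in> graded_dims" "staircase v" "z = (v, {diagram_point v})"
      by (auto simp: irreducible_components_Lvar_w0 split: if_splits)
    then obtain Y where "Y \<in> young_diagrams" "graded_dim (f_of Y) = v"
      using staircase_young_diagram by blast
    then show "z \<in> (\<lambda>Y. (graded_dim (f_of Y), X_of Y)) ` young_diagrams"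
      using v X by auto
  qed
qed

end
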